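(* Let $r$ be an integer and let $G$ be one of the following $2$-groups: (i) $D_{2^r} = \langle x,y \mid x^2 = y^{2^{r-1}} = 1,\ x^{-1}yx = y^{-1}\rangle$ with $r \ge 3$; (ii) $Q_{2^r} = \langle x,y \mid x^2 = y^{2^{r-2}},\ y^{2^{r-1}} = 1,\ x^{-1}yx = y^{-1}\rangle$ with $r \ge 3$; (iii) $SD_{2^r} = \langle x,y \mid x^2 = y^{2^{r-1}} = 1,\ x^{-1}yx = y^{2^{r-2}-1}\rangle$ with $r \ge 4$; (iv) $M_{2^r} = \langle x,y \mid x^2 = y^{2^{r-1}} = 1,\ x^{-1}yx = y^{2^{r-2}+1}\rangle$ with $r \ge 4$. Then $D(G) = L(G)$.
   Context: For a finite group $G$, $D(G)$ denotes the least positive integer $k$ such that for every sequence $g_1 g_2 \cdots g_k$ of length $k$ of elements of $G$ (repetitions allowed) there exist indices $1 \le i_1 < \cdots < i_m \le k$, $m\ge1$, with $g_{i_1} g_{i_2}\cdots g_{i_m} = 1$ (product in order of increasing indices). For a finite $2$-group $G$, $L(G)$ is the Loewy length of $\mathbb{F}_2G$, i.e. the nilpotency index of the Jacobson radical (the augmentation ideal) of $\mathbb{F}_2G$. *)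

theory Defs
  imports "HOL-Algebra.Algebra" "HOL-Number_Theory.Residues"
begin

section \<open>Groups given by generators and relations\<close>

text \<open>
  A letter \<open>(a, True)\<close> stands for the generator \<open>a\<close>, a letter \<open>(a, False)\<close> for its inverse.
  A set \<open>S\<close> of pairs \<open>(u, v)\<close> of words is read as the set of relations \<open>u = v\<close>.
\<close>

type_synonym 'g word = "('g \<times> bool) list"

definition word_gen :: "'g \<Rightarrow> 'g word"
  where "word_gen a = [(a, True)]"

definition word_inv :: "'g word \<Rightarrow> 'g word"
  where "word_inv w = rev (map (\<lambda>(a, e). (a, \<not> e)) w)"

definition word_pow :: "'g word \<Rightarrow> nat \<Rightarrow> 'g word"
  where "word_pow w n = concat (replicate n w)"

inductive word_eq :: "('g word \<times> 'g word) set \<Rightarrow> 'g word \<Rightarrow> 'g word \<Rightarrow> bool"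
  for S where
  rel: "(u, v) \<in> S \<Longrightarrow> word_eq S u v"
| cancel: "word_eq S [(a, e), (a, \<not> e)] []"
| refl: "word_eq S u u"
| sym: "word_eq S u v \<Longrightarrow> word_eq S v u"
| trans: "word_eq S u v \<Longrightarrow> word_eq S v w \<Longrightarrow> word_eq S u w"
| append: "word_eq S u u' \<Longrightarrow> word_eq S v v' \<Longrightarrow> word_eq S (u @ v) (u' @ v')"

definition word_class :: "('g word \<times> 'g word) set \<Rightarrow> 'g word \<Rightarrow> 'g word set"
  where "word_class S u = {v. word_eq S u v}"

definition presented_group :: "('g word \<times> 'g word) set \<Rightarrow> 'g word set monoid"
  where "presented_group S =
    \<lparr>carrier = range (word_class S),
     monoid.mult = (\<lambda>A B. \<Union>u\<in>A. \<Union>v\<in>B. word_class S (u @ v)),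
     one = word_class S []\<rparr>"

lemma word_class_eq_iff: "word_class S u = word_class S v \<longleftrightarrow> word_eq S u v"
  unfolding word_class_def
  by (auto intro: word_eq.intros)

lemma presented_group_mult:
  "word_class S u \<otimes>\<^bsub>presented_group S\<^esub> word_class S v = word_class S (u @ v)"
  unfolding presented_group_def word_class_def
  by (auto intro: word_eq.intros)

lemma word_eq_inv_left: "word_eq S (word_inv w @ w) []"
proof (induction w)
  case Nil
  show ?case by (simp add: word_inv_def word_eq.refl)
next
  case (Cons l w)
  obtain a e where l: "l = (a, e)" by (cases l)
  have "word_eq S [(a, \<not> e), (a, e)] []"
    using word_eq.cancel[of S a "\<not> e"] by simp
  from word_eq.append[OF word_eq.refl word_eq.append[OF this word_eq.refl]]
  have "word_eq S (word_inv w @ [(a, \<not> e), (a, e)] @ w) (word_inv w @ [] @ w)" .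
  then show ?case
    using Cons.IH by (auto simp: l word_inv_def intro: word_eq.trans)
qed

lemma group_presented_group: "group (presented_group S)"
proof (rule groupI)
  have carr: "carrier (presented_group S) = range (word_class S)"
    and one: "\<one>\<^bsub>presented_group S\<^esub> = word_class S []"
    by (simp_all add: presented_group_def)
  show "\<one>\<^bsub>presented_group S\<^esub> \<in> carrier (presented_group S)"
    by (simp add: carr one)
  fix A assume "A \<in> carrier (presented_group S)"
  then obtain u where A: "A = word_class S u" by (auto simp: carr)
  show "\<one>\<^bsub>presented_group S\<^esub> \<otimes>\<^bsub>presented_group S\<^esub> A = A"
    by (simp add: A one presented_group_mult)
  have "word_class S (word_inv u) \<otimes>\<^bsub>presented_group S\<^esub> A = \<one>\<^bsub>presented_group S\<^esub>"
    by (simp add: A one presented_group_mult word_class_eq_iff word_eq_inv_left)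
  then show "\<exists>B\<in>carrier (presented_group S).
      B \<otimes>\<^bsub>presented_group S\<^esub> A = \<one>\<^bsub>presented_group S\<^esub>"
    by (auto simp: carr)
  fix B assume "B \<in> carrier (presented_group S)"
  then obtain v where B: "B = word_class S v" by (auto simp: carr)
  show "A \<otimes>\<^bsub>presented_group S\<^esub> B \<in> carrier (presented_group S)"
    by (simp add: A B carr presented_group_mult)
  fix C assume "C \<in> carrier (presented_group S)"
  then obtain w where C: "C = word_class S w" by (auto simp: carr)
  show "A \<otimes>\<^bsub>presented_group S\<^esub> B \<otimes>\<^bsub>presented_group S\<^esub> C =
      A \<otimes>\<^bsub>presented_group S\<^esub> (B \<otimes>\<^bsub>presented_group S\<^esub> C)"
    by (simp add: A B C presented_group_mult)
qed

datatype xy = GenX | GenY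

abbreviation wx :: "xy word" where "wx \<equiv> word_gen GenX"
abbreviation wy :: "xy word" where "wy \<equiv> word_gen GenY"

text \<open>The parameter \<open>r\<close> is the exponent of the order \<open>2 ^ r\<close>.\<close>

definition dihedral_2group :: "nat \<Rightarrow> xy word set monoid"
  where "dihedral_2group r = presented_group
    {(word_pow wx 2, []), (word_pow wy (2 ^ (r - 1)), []),
     (word_inv wx @ wy @ wx, word_inv wy)}"

definition quaternion_2group :: "nat \<Rightarrow> xy word set monoid"
  where "quaternion_2group r = presented_group
    {(word_pow wx 2, word_pow wy (2 ^ (r - 2))), (word_pow wy (2 ^ (r - 1)), []),
     (word_inv wx @ wy @ wx, word_inv wy)}"

definition semidihedral_2group :: "nat \<Rightarrow> xy word set monoid"
  where "semidihedral_2group r = presented_group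
    {(word_pow wx 2, []), (word_pow wy (2 ^ (r - 1)), []),
     (word_inv wx @ wy @ wx, word_pow wy (2 ^ (r - 2) - 1))}"

definition modular_2group :: "nat \<Rightarrow> xy word set monoid"
  where "modular_2group r = presented_group
    {(word_pow wx 2, []), (word_pow wy (2 ^ (r - 1)), []),
     (word_inv wx @ wy @ wx, word_pow wy (2 ^ (r - 2) + 1))}"


section \<open>The ordered Davenport constant\<close>

text \<open>
  \<open>nths gs I\<close> keeps the entries of \<open>gs\<close> at the (0-based) positions in \<open>I\<close>, in increasing order.
\<close>

definition has_ordered_one_product :: "('a, 'b) monoid_scheme \<Rightarrow> 'a list \<Rightarrow> bool"
  where "has_ordered_one_product G gs \<longleftrightarrow>
    (\<exists>I. I \<noteq> {} \<and> I \<subseteq> {..<length gs} \<and> foldr (\<otimes>\<^bsub>G\<^esub>) (nths gs I) \<one>\<^bsub>G\<^esub> = \<one>\<^bsub>G\<^esub>)"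

definition ordered_davenport :: "('a, 'b) monoid_scheme \<Rightarrow> nat"
  where "ordered_davenport G =
    (LEAST k. 0 < k \<and>
      (\<forall>gs. length gs = k \<and> set gs \<subseteq> carrier G \<longrightarrow> has_ordered_one_product G gs))"


section \<open>Group algebras and Loewy length\<close>

text \<open>Meant for finite \<open>G\<close> only: no finite-support condition is imposed.\<close>

definition group_algebra :: "('r, 'm) ring_scheme \<Rightarrow> ('a, 'b) monoid_scheme \<Rightarrow> ('a \<Rightarrow> 'r) ring"
  where "group_algebra R G =
    \<lparr>carrier = carrier G \<rightarrow>\<^sub>E carrier R,
     monoid.mult = (\<lambda>f g. \<lambda>x\<in>carrier G.
       \<Oplus>\<^bsub>R\<^esub>y\<in>carrier G. f y \<otimes>\<^bsub>R\<^esub> g (inv\<^bsub>G\<^esub> y \<otimes>\<^bsub>G\<^esub> x)),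
     monoid.one = (\<lambda>x\<in>carrier G. if x = \<one>\<^bsub>G\<^esub> then \<one>\<^bsub>R\<^esub> else \<zero>\<^bsub>R\<^esub>),
     ring.zero = (\<lambda>x\<in>carrier G. \<zero>\<^bsub>R\<^esub>),
     ring.add = (\<lambda>f g. \<lambda>x\<in>carrier G. f x \<oplus>\<^bsub>R\<^esub> g x)\<rparr>"

definition left_ideal :: "'a set \<Rightarrow> ('a, 'b) ring_scheme \<Rightarrow> bool"
  where "left_ideal I R \<longleftrightarrow>
    additive_subgroup I R \<and> (\<forall>a\<in>carrier R. \<forall>x\<in>I. a \<otimes>\<^bsub>R\<^esub> x \<in> I)"

definition maximal_left_ideal :: "'a set \<Rightarrow> ('a, 'b) ring_scheme \<Rightarrow> bool"
  where "maximal_left_ideal I R \<longleftrightarrow>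
    left_ideal I R \<and> I \<noteq> carrier R \<and>
    (\<forall>J. left_ideal J R \<and> I \<subseteq> J \<longrightarrow> J = I \<or> J = carrier R)"

definition jacobson_radical :: "('a, 'b) ring_scheme \<Rightarrow> 'a set"
  where "jacobson_radical R = carrier R \<inter> \<Inter> {I. maximal_left_ideal I R}"

primrec ideal_pow :: "('a, 'b) ring_scheme \<Rightarrow> 'a set \<Rightarrow> nat \<Rightarrow> 'a set"
  where
    "ideal_pow R I 0 = carrier R"
  | "ideal_pow R I (Suc n) = ideal_prod R (ideal_pow R I n) I"

text \<open>Meaningful for rings whose Jacobson radical is nilpotent, such as Artinian rings.\<close>

definition loewy_length :: "('a, 'b) ring_scheme \<Rightarrow> nat"
  where "loewy_length R = (LEAST n. ideal_pow R (jacobson_radical R) n = {\<zero>\<^bsub>R\<^esub>})"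

definition loewy_length_F2 :: "('a, 'b) monoid_scheme \<Rightarrow> nat"
  where "loewy_length_F2 G = loewy_length (group_algebra (residue_ring 2) G)"

end

theory Submission
  imports Defs "HOL-Library.Sublist"
begin

text \<open>
  With \<open>n = 2\<^sup>r\<^sup>-\<^sup>1\<close>, both sides equal \<open>n + 1\<close>. Write \<open>\<Delta>\<close> for the augmentation ideal of
  \<open>F\<^sub>2G\<close> and \<open>Y = y - 1\<close>. The relations give \<open>\<Delta>\<Delta> \<subseteq> \<Delta>Y\<close>; as the \<open>g\<close> with \<open>g - 1\<close> in a given
  left ideal form a subgroup, this need only be checked on \<open>x\<close> and \<open>y\<close>. Hence
  \<open>\<Delta>\<^sup>n\<^sup>+\<^sup>1 \<subseteq> \<Delta>Y\<^sup>n = 0\<close>, and \<open>\<Delta>\<close> is the Jacobson radical. If \<open>g\<^sub>1, \<dots>, g\<^sub>k\<close> has no ordered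
  subproduct equal to \<open>1\<close>, then the coefficient of \<open>1\<close> in \<open>(g\<^sub>1 - 1) \<dots> (g\<^sub>k - 1)\<close> is \<open>1\<close>,
  so \<open>\<Delta>\<^sup>k\<close> is nonzero: thus \<open>D(G) \<le> L(G) \<le> n + 1\<close>. The sequence \<open>y, \<dots>, y, x\<close> of length \<open>n\<close>
  shows \<open>n < D(G)\<close>, because \<open>y\<close> has order \<open>n\<close> and \<open>x\<close> is not a power of \<open>y\<close>; both are
  read off an action of the presented group on normal forms \<open>x\<^sup>s y\<^sup>b\<close>.
\<close>

section \<open>Group rings of finite groups\<close>

text \<open>Associativity of the convolution product rests on this exchange of sums.\<close>

lemma (in abelian_monoid) finsum_swap:
  assumes "finite A" "finite B" "\<And>x y. x \<in> A \<Longrightarrow> y \<in> B \<Longrightarrow> f x y \<in> carrier G"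
  shows "(\<Oplus>x\<in>A. \<Oplus>y\<in>B. f x y) = (\<Oplus>y\<in>B. \<Oplus>x\<in>A. f x y)"
  using assms(1,3)
proof (induction A)
  case empty
  then show ?case by simp
next
  case (insert a A)
  have "(\<Oplus>x\<in>insert a A. \<Oplus>y\<in>B. f x y) = (\<Oplus>y\<in>B. f a y) \<oplus> (\<Oplus>y\<in>B. \<Oplus>x\<in>A. f x y)"
    using insert by (subst finsum_insert) (auto intro!: finsum_closed)
  also have "\<dots> = (\<Oplus>y\<in>B. f a y \<oplus> (\<Oplus>x\<in>A. f x y))"
    using insert by (subst finsum_addf) (auto intro!: finsum_closed)
  also have "\<dots> = (\<Oplus>y\<in>B. \<Oplus>x\<in>insert a A. f x y)"
    using insert by (intro finsum_cong') (auto intro!: finsum_closed)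
  finally show ?case .
qed

locale finite_group_ring = R: ring R + G: group G
  for R :: "('r, 'm) ring_scheme" (structure) and G :: "('a, 'b) monoid_scheme" +
  assumes finite_carrier: "finite (carrier G)"
begin

abbreviation RG :: "('a \<Rightarrow> 'r) ring" where "RG \<equiv> group_algebra R G"

definition point :: "'a \<Rightarrow> 'a \<Rightarrow> 'r"
  where "point g = (\<lambda>x\<in>carrier G. if x = g then \<one> else \<zero>)"

lemma carrier_RG: "carrier RG = carrier G \<rightarrow>\<^sub>E carrier R"
  by (simp add: group_algebra_def)

lemma RG_eqI:
  assumes "f \<in> carrier RG" "g \<in> carrier RG" "\<And>x. x \<in> carrier G \<Longrightarrow> f x = g x"
  shows "f = g"
  using assms by (auto simp: carrier_RG intro: PiE_ext)

lemma RG_coeff_closed: "f \<in> carrier RG \<Longrightarrow> x \<in> carrier G \<Longrightarrow> f x \<in> carrier R"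
  by (auto simp: carrier_RG)

lemma RG_add: "f \<oplus>\<^bsub>RG\<^esub> g = (\<lambda>x\<in>carrier G. f x \<oplus> g x)"
  by (simp add: group_algebra_def)

lemma RG_zero: "\<zero>\<^bsub>RG\<^esub> = (\<lambda>x\<in>carrier G. \<zero>)"
  by (simp add: group_algebra_def)

lemma RG_one: "\<one>\<^bsub>RG\<^esub> = point \<one>\<^bsub>G\<^esub>"
  by (simp add: group_algebra_def point_def)

lemma RG_mult: "f \<otimes>\<^bsub>RG\<^esub> g =
    (\<lambda>x\<in>carrier G. \<Oplus>y\<in>carrier G. f y \<otimes> g (inv\<^bsub>G\<^esub> y \<otimes>\<^bsub>G\<^esub> x))"
  by (simp add: group_algebra_def)

lemma RG_mult_coeff_closed:
  "f \<in> carrier RG \<Longrightarrow> g \<in> carrier RG \<Longrightarrow> x \<in> carrier G \<Longrightarrow>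
    (\<Oplus>y\<in>carrier G. f y \<otimes> g (inv\<^bsub>G\<^esub> y \<otimes>\<^bsub>G\<^esub> x)) \<in> carrier R"
  by (intro R.finsum_closed) (auto simp: RG_coeff_closed)

lemma RG_mult_closed: "f \<in> carrier RG \<Longrightarrow> g \<in> carrier RG \<Longrightarrow> f \<otimes>\<^bsub>RG\<^esub> g \<in> carrier RG"
  unfolding RG_mult by (subst carrier_RG) (auto simp: RG_mult_coeff_closed)

lemma RG_add_closed: "f \<in> carrier RG \<Longrightarrow> g \<in> carrier RG \<Longrightarrow> f \<oplus>\<^bsub>RG\<^esub> g \<in> carrier RG"
  unfolding RG_add by (subst carrier_RG) (auto simp: RG_coeff_closed)

lemma point_closed: "point g \<in> carrier RG"
  by (auto simp: carrier_RG point_def)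

lemma mult_point:
  assumes "f \<in> carrier RG" "g \<in> carrier G" "x \<in> carrier G"
  shows "(f \<otimes>\<^bsub>RG\<^esub> point g) x = f (x \<otimes>\<^bsub>G\<^esub> inv\<^bsub>G\<^esub> g)"
proof -
  have eq: "inv\<^bsub>G\<^esub> y \<otimes>\<^bsub>G\<^esub> x = g \<longleftrightarrow> x \<otimes>\<^bsub>G\<^esub> inv\<^bsub>G\<^esub> g = y" if "y \<in> carrier G" for y
    using assms that by (metis G.inv_solve_left' G.inv_solve_right' G.inv_closed)
  have "(f \<otimes>\<^bsub>RG\<^esub> point g) x = (\<Oplus>y\<in>carrier G. if x \<otimes>\<^bsub>G\<^esub> inv\<^bsub>G\<^esub> g = y then f y else \<zero>)"
    unfolding RG_mult using assms
    by (auto intro!: R.finsum_cong' simp: point_def eq RG_coeff_closed)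
  also have "\<dots> = f (x \<otimes>\<^bsub>G\<^esub> inv\<^bsub>G\<^esub> g)"
    using assms by (intro R.finsum_singleton) (auto simp: finite_carrier RG_coeff_closed)
  finally show ?thesis .
qed

lemma point_mult:
  assumes "f \<in> carrier RG" "g \<in> carrier G" "x \<in> carrier G"
  shows "(point g \<otimes>\<^bsub>RG\<^esub> f) x = f (inv\<^bsub>G\<^esub> g \<otimes>\<^bsub>G\<^esub> x)"
proof -
  have "(point g \<otimes>\<^bsub>RG\<^esub> f) x =
      (\<Oplus>y\<in>carrier G. if g = y then f (inv\<^bsub>G\<^esub> y \<otimes>\<^bsub>G\<^esub> x) else \<zero>)"
    unfolding RG_mult using assms
    by (auto intro!: R.finsum_cong' simp: point_def RG_coeff_closed)
  also have "\<dots> = f (inv\<^bsub>G\<^esub> g \<otimes>\<^bsub>G\<^esub> x)"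
    using assms by (intro R.finsum_singleton) (auto simp: finite_carrier RG_coeff_closed)
  finally show ?thesis .
qed

lemma point_mult_point:
  assumes "g \<in> carrier G" "h \<in> carrier G"
  shows "point g \<otimes>\<^bsub>RG\<^esub> point h = point (g \<otimes>\<^bsub>G\<^esub> h)"
proof (rule RG_eqI)
  fix x assume x: "x \<in> carrier G"
  have "inv\<^bsub>G\<^esub> g \<otimes>\<^bsub>G\<^esub> x = h \<longleftrightarrow> x = g \<otimes>\<^bsub>G\<^esub> h"
    using assms x by (metis G.inv_solve_left' G.inv_closed)
  then show "(point g \<otimes>\<^bsub>RG\<^esub> point h) x = point (g \<otimes>\<^bsub>G\<^esub> h) x"
    using assms x by (simp add: point_mult point_closed) (simp add: point_def)
qed (auto simp: RG_mult_closed point_closed)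

text \<open>Both sides are a double sum over \<open>y\<close> and \<open>z\<close>. Translating the
  summation variable of the inner product by the inverse of \<open>z\<close> (the fact
  \<open>inner\<close>) reduces the claim to exchanging the two sums.\<close>

lemma RG_assoc:
  assumes "f \<in> carrier RG" "g \<in> carrier RG" "h \<in> carrier RG"
  shows "(f \<otimes>\<^bsub>RG\<^esub> g) \<otimes>\<^bsub>RG\<^esub> h = f \<otimes>\<^bsub>RG\<^esub> (g \<otimes>\<^bsub>RG\<^esub> h)"
proof (rule RG_eqI)
  note cl = assms[THEN RG_coeff_closed]
  fix x assume x: "x \<in> carrier G"
  have inner: "(\<Oplus>y\<in>carrier G. g (inv\<^bsub>G\<^esub> z \<otimes>\<^bsub>G\<^esub> y) \<otimes> h (inv\<^bsub>G\<^esub> y \<otimes>\<^bsub>G\<^esub> x)) =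
      (g \<otimes>\<^bsub>RG\<^esub> h) (inv\<^bsub>G\<^esub> z \<otimes>\<^bsub>G\<^esub> x)" if z: "z \<in> carrier G" for z
  proof -
    have im: "(\<lambda>y. inv\<^bsub>G\<^esub> z \<otimes>\<^bsub>G\<^esub> y) ` carrier G = carrier G"
    proof (intro equalityI subsetI)
      fix w assume "w \<in> carrier G"
      then show "w \<in> (\<lambda>y. inv\<^bsub>G\<^esub> z \<otimes>\<^bsub>G\<^esub> y) ` carrier G"
        using z by (intro image_eqI[of _ _ "z \<otimes>\<^bsub>G\<^esub> w"]) (auto simp: G.m_assoc[symmetric])
    qed (use z in auto)
    have inj: "inj_on (\<lambda>y. inv\<^bsub>G\<^esub> z \<otimes>\<^bsub>G\<^esub> y) (carrier G)"
      using z by (auto intro!: inj_onI)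
    have "(g \<otimes>\<^bsub>RG\<^esub> h) (inv\<^bsub>G\<^esub> z \<otimes>\<^bsub>G\<^esub> x) =
        (\<Oplus>w\<in>(\<lambda>y. inv\<^bsub>G\<^esub> z \<otimes>\<^bsub>G\<^esub> y) ` carrier G.
          g w \<otimes> h (inv\<^bsub>G\<^esub> w \<otimes>\<^bsub>G\<^esub> (inv\<^bsub>G\<^esub> z \<otimes>\<^bsub>G\<^esub> x)))"
      using z x by (simp add: RG_mult im)
    also have "\<dots> = (\<Oplus>y\<in>carrier G. g (inv\<^bsub>G\<^esub> z \<otimes>\<^bsub>G\<^esub> y) \<otimes>
        h (inv\<^bsub>G\<^esub> (inv\<^bsub>G\<^esub> z \<otimes>\<^bsub>G\<^esub> y) \<otimes>\<^bsub>G\<^esub> (inv\<^bsub>G\<^esub> z \<otimes>\<^bsub>G\<^esub> x)))"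
      by (rule R.finsum_reindex) (use inj im z x cl in auto)
    also have "\<dots> = (\<Oplus>y\<in>carrier G. g (inv\<^bsub>G\<^esub> z \<otimes>\<^bsub>G\<^esub> y) \<otimes> h (inv\<^bsub>G\<^esub> y \<otimes>\<^bsub>G\<^esub> x))"
    proof (rule R.finsum_cong')
      fix y assume y: "y \<in> carrier G"
      have "inv\<^bsub>G\<^esub> (inv\<^bsub>G\<^esub> z \<otimes>\<^bsub>G\<^esub> y) \<otimes>\<^bsub>G\<^esub> (inv\<^bsub>G\<^esub> z \<otimes>\<^bsub>G\<^esub> x) =
          inv\<^bsub>G\<^esub> y \<otimes>\<^bsub>G\<^esub> (z \<otimes>\<^bsub>G\<^esub> (inv\<^bsub>G\<^esub> z \<otimes>\<^bsub>G\<^esub> x))"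
        using x y z by (simp add: G.inv_mult_group G.m_assoc)
      also have "z \<otimes>\<^bsub>G\<^esub> (inv\<^bsub>G\<^esub> z \<otimes>\<^bsub>G\<^esub> x) = x"
        using x z by (simp add: G.m_assoc[symmetric])
      finally show "g (inv\<^bsub>G\<^esub> z \<otimes>\<^bsub>G\<^esub> y) \<otimes>
          h (inv\<^bsub>G\<^esub> (inv\<^bsub>G\<^esub> z \<otimes>\<^bsub>G\<^esub> y) \<otimes>\<^bsub>G\<^esub> (inv\<^bsub>G\<^esub> z \<otimes>\<^bsub>G\<^esub> x)) =
          g (inv\<^bsub>G\<^esub> z \<otimes>\<^bsub>G\<^esub> y) \<otimes> h (inv\<^bsub>G\<^esub> y \<otimes>\<^bsub>G\<^esub> x)" by simp
    qed (use z x cl in auto)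
    finally show ?thesis by simp
  qed
  have "((f \<otimes>\<^bsub>RG\<^esub> g) \<otimes>\<^bsub>RG\<^esub> h) x = (\<Oplus>y\<in>carrier G.
      (\<Oplus>z\<in>carrier G. f z \<otimes> g (inv\<^bsub>G\<^esub> z \<otimes>\<^bsub>G\<^esub> y)) \<otimes> h (inv\<^bsub>G\<^esub> y \<otimes>\<^bsub>G\<^esub> x))"
    using x assms by (auto intro!: R.finsum_cong' simp: RG_mult RG_mult_coeff_closed cl)
  also have "\<dots> = (\<Oplus>y\<in>carrier G. \<Oplus>z\<in>carrier G.
      f z \<otimes> (g (inv\<^bsub>G\<^esub> z \<otimes>\<^bsub>G\<^esub> y) \<otimes> h (inv\<^bsub>G\<^esub> y \<otimes>\<^bsub>G\<^esub> x)))"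
    using x by (intro R.finsum_cong')
      (auto simp: R.finsum_ldistr finite_carrier cl R.m_assoc Pi_def intro!: R.finsum_cong' R.finsum_closed)
  also have "\<dots> = (\<Oplus>z\<in>carrier G. \<Oplus>y\<in>carrier G.
      f z \<otimes> (g (inv\<^bsub>G\<^esub> z \<otimes>\<^bsub>G\<^esub> y) \<otimes> h (inv\<^bsub>G\<^esub> y \<otimes>\<^bsub>G\<^esub> x)))"
    using x by (intro R.finsum_swap) (auto simp: finite_carrier cl)
  also have "\<dots> = (\<Oplus>z\<in>carrier G. f z \<otimes> (g \<otimes>\<^bsub>RG\<^esub> h) (inv\<^bsub>G\<^esub> z \<otimes>\<^bsub>G\<^esub> x))"
    using x assms by (intro R.finsum_cong')
      (auto simp: R.finsum_rdistr[symmetric] finite_carrier cl inner RG_mult_closed RG_coeff_closed Pi_def)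
  also have "\<dots> = (f \<otimes>\<^bsub>RG\<^esub> (g \<otimes>\<^bsub>RG\<^esub> h)) x"
    using x by (simp add: RG_mult[of f])
  finally show "((f \<otimes>\<^bsub>RG\<^esub> g) \<otimes>\<^bsub>RG\<^esub> h) x = (f \<otimes>\<^bsub>RG\<^esub> (g \<otimes>\<^bsub>RG\<^esub> h)) x" .
qed (use assms in \<open>auto simp: RG_mult_closed\<close>)

lemma ring_RG: "ring RG"
proof (rule ringI)
  show "abelian_group RG"
  proof (rule abelian_groupI)
    fix f assume f: "f \<in> carrier RG"
    have "(\<lambda>x\<in>carrier G. \<ominus> f x) \<in> carrier RG"
      using f by (simp add: carrier_RG PiE_iff)
    moreover have "(\<lambda>x\<in>carrier G. \<ominus> f x) \<oplus>\<^bsub>RG\<^esub> f = \<zero>\<^bsub>RG\<^esub>"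
      using f by (auto simp: RG_add RG_zero R.l_neg RG_coeff_closed)
    ultimately show "\<exists>g\<in>carrier RG. g \<oplus>\<^bsub>RG\<^esub> f = \<zero>\<^bsub>RG\<^esub>" by blast
    show "\<zero>\<^bsub>RG\<^esub> \<oplus>\<^bsub>RG\<^esub> f = f"
      using f by (auto simp: carrier_RG RG_add RG_zero PiE_iff extensional_def)
  qed (auto simp: RG_add_closed,
      auto simp: RG_add RG_zero carrier_RG R.a_ac PiE_iff intro!: restrict_ext)
  show "monoid RG"
  proof (rule monoidI)
    fix f assume f: "f \<in> carrier RG"
    show "\<one>\<^bsub>RG\<^esub> \<otimes>\<^bsub>RG\<^esub> f = f" "f \<otimes>\<^bsub>RG\<^esub> \<one>\<^bsub>RG\<^esub> = f"
      using f by (auto intro!: RG_eqI simp: RG_one RG_mult_closed point_closed point_mult mult_point)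
  qed (auto simp: RG_mult_closed RG_one point_closed RG_assoc)
  fix f g h assume fgh: "f \<in> carrier RG" "g \<in> carrier RG" "h \<in> carrier RG"
  note cl = fgh[THEN RG_coeff_closed]
  show "(f \<oplus>\<^bsub>RG\<^esub> g) \<otimes>\<^bsub>RG\<^esub> h = f \<otimes>\<^bsub>RG\<^esub> h \<oplus>\<^bsub>RG\<^esub> g \<otimes>\<^bsub>RG\<^esub> h"
  proof (rule RG_eqI)
    fix x assume x: "x \<in> carrier G"
    have "((f \<oplus>\<^bsub>RG\<^esub> g) \<otimes>\<^bsub>RG\<^esub> h) x = (\<Oplus>y\<in>carrier G.
        f y \<otimes> h (inv\<^bsub>G\<^esub> y \<otimes>\<^bsub>G\<^esub> x) \<oplus> g y \<otimes> h (inv\<^bsub>G\<^esub> y \<otimes>\<^bsub>G\<^esub> x))"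
      using x by (auto simp: RG_mult RG_add R.l_distr cl simp del: R.finsum_addf R.add.finprod_multf intro!: R.finsum_cong')
    also have "\<dots> = (f \<otimes>\<^bsub>RG\<^esub> h \<oplus>\<^bsub>RG\<^esub> g \<otimes>\<^bsub>RG\<^esub> h) x"
      using x by (subst R.finsum_addf) (auto simp: RG_mult RG_add cl)
    finally show "((f \<oplus>\<^bsub>RG\<^esub> g) \<otimes>\<^bsub>RG\<^esub> h) x = (f \<otimes>\<^bsub>RG\<^esub> h \<oplus>\<^bsub>RG\<^esub> g \<otimes>\<^bsub>RG\<^esub> h) x" .
  qed (use fgh in \<open>auto simp: RG_mult_closed RG_add_closed\<close>)
  show "h \<otimes>\<^bsub>RG\<^esub> (f \<oplus>\<^bsub>RG\<^esub> g) = h \<otimes>\<^bsub>RG\<^esub> f \<oplus>\<^bsub>RG\<^esub> h \<otimes>\<^bsub>RG\<^esub> g"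
  proof (rule RG_eqI)
    fix x assume x: "x \<in> carrier G"
    have "(h \<otimes>\<^bsub>RG\<^esub> (f \<oplus>\<^bsub>RG\<^esub> g)) x = (\<Oplus>y\<in>carrier G.
        h y \<otimes> f (inv\<^bsub>G\<^esub> y \<otimes>\<^bsub>G\<^esub> x) \<oplus> h y \<otimes> g (inv\<^bsub>G\<^esub> y \<otimes>\<^bsub>G\<^esub> x))"
      using x by (auto simp: RG_mult RG_add R.r_distr cl simp del: R.finsum_addf R.add.finprod_multf intro!: R.finsum_cong')
    also have "\<dots> = (h \<otimes>\<^bsub>RG\<^esub> f \<oplus>\<^bsub>RG\<^esub> h \<otimes>\<^bsub>RG\<^esub> g) x"
      using x by (subst R.finsum_addf) (auto simp: RG_mult RG_add cl)
    finally show "(h \<otimes>\<^bsub>RG\<^esub> (f \<oplus>\<^bsub>RG\<^esub> g)) x = (h \<otimes>\<^bsub>RG\<^esub> f \<oplus>\<^bsub>RG\<^esub> h \<otimes>\<^bsub>RG\<^esub> g) x" .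
  qed (use fgh in \<open>auto simp: RG_mult_closed RG_add_closed\<close>)
qed

end

section \<open>Left ideals, the Jacobson radical and powers of an ideal\<close>

lemma (in ring) left_ideal_closed:
  assumes "left_ideal I R"
  shows "I \<subseteq> carrier R" "\<zero> \<in> I" "a \<in> I \<Longrightarrow> b \<in> I \<Longrightarrow> a \<oplus> b \<in> I"
    "a \<in> I \<Longrightarrow> \<ominus> a \<in> I" "a \<in> I \<Longrightarrow> b \<in> I \<Longrightarrow> a \<ominus> b \<in> I"
    "c \<in> carrier R \<Longrightarrow> a \<in> I \<Longrightarrow> c \<otimes> a \<in> I"
  using assms unfolding left_ideal_def a_minus_def
  by (auto simp: additive_subgroup.a_subset additive_subgroup.zero_closed
      additive_subgroup.a_closed additive_subgroup.a_inv_closed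
      dest: additive_subgroup.a_subset)

lemma (in ring) left_idealI:
  assumes "I \<subseteq> carrier R" "\<zero> \<in> I" "\<And>a b. a \<in> I \<Longrightarrow> b \<in> I \<Longrightarrow> a \<oplus> b \<in> I"
    "\<And>c a. c \<in> carrier R \<Longrightarrow> a \<in> I \<Longrightarrow> c \<otimes> a \<in> I"
  shows "left_ideal I R"
proof -
  have "\<ominus> a \<in> I" if "a \<in> I" for a
  proof -
    have "\<ominus> a = (\<ominus> \<one>) \<otimes> a"
      using that assms(1) by (auto simp: l_minus)
    then show ?thesis using that assms(4) by simp
  qed
  then have "additive_subgroup I R"
    using assms by (intro additive_subgroup.intro add.subgroupI) (auto simp: a_inv_def)
  then show ?thesis using assms(4) by (simp add: left_ideal_def)
qed

lemma (in ring) left_ideal_eq_carrier: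
  assumes "left_ideal M R" "\<one> \<in> M"
  shows "M = carrier R"
proof
  show "M \<subseteq> carrier R" by (rule left_ideal_closed(1)[OF assms(1)])
  show "carrier R \<subseteq> M"
    using left_ideal_closed(6)[OF assms(1) _ assms(2)] by (metis r_one subsetI)
qed

text \<open>If \<open>\<one> \<ominus> u\<close> were in \<open>M\<close>, then by telescoping so
  would be every \<open>\<one> \<ominus> u [^] j\<close>, and \<open>j = k\<close> would put
  \<open>\<one>\<close> into \<open>M\<close>. The factor \<open>u [^] j\<close> stands on the left
  because \<open>M\<close> is only a left ideal.\<close>

lemma (in ring) proper_left_ideal_one_minus_nilpotent:
  assumes M: "left_ideal M R" "M \<noteq> carrier R"
    and u: "u \<in> carrier R" "u [^] (k::nat) = \<zero>"
  shows "\<one> \<ominus> u \<notin> M"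
proof
  assume *: "\<one> \<ominus> u \<in> M"
  have "\<one> \<ominus> u [^] j \<in> M" for j :: nat
  proof (induction j)
    case 0
    then show ?case using left_ideal_closed(2)[OF M(1)] by (simp add: a_minus_def r_neg)
  next
    case (Suc j)
    have p: "u [^] j \<in> carrier R" using u by simp
    have "u [^] j \<otimes> (\<one> \<ominus> u) = u [^] j \<ominus> u [^] Suc j"
      using u p by (simp add: a_minus_def r_distr r_minus)
    then have "\<one> \<ominus> u [^] Suc j = (\<one> \<ominus> u [^] j) \<oplus> u [^] j \<otimes> (\<one> \<ominus> u)"
      using u p by (simp add: a_minus_def a_ac r_neg1 r_neg2)
    then show ?case
      using Suc * p left_ideal_closed(3,6)[OF M(1)] by simp
  qed
  from this[of k] have "\<one> \<in> M" using u by (simp add: a_minus_def)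
  then show False using left_ideal_eq_carrier M by blast
qed

text \<open>The hypotheses make the ring local. A proper left ideal with an element \<open>a\<close>
  outside \<open>I\<close> would contain \<open>a = \<one> \<ominus> u\<close> with
  \<open>u = \<one> \<ominus> a\<close> nilpotent, which is impossible. So every proper left ideal
  lies in \<open>I\<close>, and \<open>I\<close> is the only maximal one.\<close>

lemma (in ring) jacobson_radical_eqI:
  assumes I: "left_ideal I R" "\<one> \<notin> I"
    and nil: "\<And>u. u \<in> I \<Longrightarrow> \<exists>k::nat. u [^] k = \<zero>"
    and loc: "\<And>a. a \<in> carrier R \<Longrightarrow> a \<in> I \<or> \<one> \<ominus> a \<in> I"
  shows "jacobson_radical R = I"
proof -
  have sub: "M \<subseteq> I" if M: "left_ideal M R" "M \<noteq> carrier R" for M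
  proof
    fix a assume a: "a \<in> M"
    then have ac: "a \<in> carrier R" using left_ideal_closed(1)[OF M(1)] by blast
    show "a \<in> I"
    proof (rule ccontr)
      assume "a \<notin> I"
      then have u: "\<one> \<ominus> a \<in> I" using loc ac by blast
      then obtain k :: nat where "(\<one> \<ominus> a) [^] k = \<zero>" using nil by blast
      moreover have "\<one> \<ominus> (\<one> \<ominus> a) = a"
        using ac by (simp add: a_minus_def minus_add r_neg2)
      ultimately show False
        using proper_left_ideal_one_minus_nilpotent[OF M, of "\<one> \<ominus> a" k] a ac by simp
    qed
  qed
  have ne: "I \<noteq> carrier R" using I(2) by auto
  have "maximal_left_ideal I R"
    using I(1) ne sub unfolding maximal_left_ideal_def by blast
  moreover have "M = I" if "maximal_left_ideal M R" for M
    using that I(1) ne sub[of M] unfolding maximal_left_ideal_def by auto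
  ultimately have "{M. maximal_left_ideal M R} = {I}" by blast
  then show ?thesis
    using left_ideal_closed(1)[OF I(1)] by (auto simp: jacobson_radical_def)
qed

section \<open>Powers of an ideal\<close>

lemma (in ring) nat_pow_in_ideal_pow:
  assumes "u \<in> I" "I \<subseteq> carrier R"
  shows "u [^] (k::nat) \<in> ideal_pow R I k"
  using assms by (induction k) (auto intro: ideal_prod.prod)

lemma (in ring) zero_in_ideal_pow:
  assumes "\<zero> \<in> I"
  shows "\<zero> \<in> ideal_pow R I k"
proof (induction k)
  case (Suc k)
  then have "\<zero> \<otimes> \<zero> \<in> ideal_prod R (ideal_pow R I k) I"
    using assms by (intro ideal_prod.prod)
  then show ?case by simp
qed simp

text \<open>Induction on \<open>k\<close>: each further factor from \<open>I\<close> is moved to the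
  left of \<open>b [^] k\<close> and then absorbed by \<open>sq\<close>, which yields one more
  \<open>b\<close>.\<close>

lemma (in ring) ideal_pow_subset_right_multiples:
  assumes I: "left_ideal I R" and b: "b \<in> I"
    and sq: "\<And>a c. a \<in> I \<Longrightarrow> c \<in> I \<Longrightarrow> \<exists>d\<in>I. a \<otimes> c = d \<otimes> b"
  shows "ideal_pow R I (Suc k) \<subseteq> (\<lambda>a. a \<otimes> b [^] k) ` I"
proof (induction k)
  note cl = left_ideal_closed[OF I]
  have car: "a \<in> carrier R" if "a \<in> I" for a using cl(1) that by blast
  case 0
  have "s \<in> I" if "s \<in> ideal_prod R (carrier R) I" for s
    using that by induction (auto simp: cl)
  then show ?case using car by (auto simp: image_iff)
next
  note cl = left_ideal_closed[OF I]
  have car: "a \<in> carrier R" if "a \<in> I" for a using cl(1) that by blast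
  \<comment> \<open>As \<open>b \<in> I\<close>, the product \<open>b \<otimes> c\<close> is again
    of the form \<open>d \<otimes> b\<close>; iterating this moves \<open>b [^] k\<close> past an
    element of \<open>I\<close>.\<close>
  have comm: "\<exists>d\<in>I. b [^] k \<otimes> c = d \<otimes> b [^] k" if "c \<in> I" for c and k :: nat
    using that
  proof (induction k arbitrary: c)
    case 0
    then show ?case using car by auto
  next
    case (Suc k)
    obtain d where d: "d \<in> I" "b \<otimes> c = d \<otimes> b" using sq b Suc.prems by blast
    obtain e where e: "e \<in> I" "b [^] k \<otimes> d = e \<otimes> b [^] k" using Suc.IH d by blast
    have "b [^] Suc k \<otimes> c = b [^] k \<otimes> (d \<otimes> b)"
      using car b Suc.prems d by (simp add: m_assoc)
    also have "\<dots> = e \<otimes> b [^] Suc k"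
      using car b d e by (simp add: m_assoc[symmetric])
    finally show ?case using e by blast
  qed
  case (Suc k)
  show ?case
  proof
    fix s assume "s \<in> ideal_pow R I (Suc (Suc k))"
    then have "s \<in> ideal_prod R (ideal_pow R I (Suc k)) I" by simp
    then show "s \<in> (\<lambda>a. a \<otimes> b [^] Suc k) ` I"
    proof induction
      case (prod i j)
      then obtain u where u: "u \<in> I" "i = u \<otimes> b [^] k" using Suc.IH by blast
      obtain d where d: "d \<in> I" "b [^] k \<otimes> j = d \<otimes> b [^] k" using comm prod by blast
      obtain w where w: "w \<in> I" "u \<otimes> d = w \<otimes> b" using sq u d by blast
      have bk: "b [^] k \<in> carrier R" using car b by simp
      have "i \<otimes> j = u \<otimes> (d \<otimes> b [^] k)"
        using u d prod car bk by (simp add: m_assoc)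
      also have "\<dots> = (w \<otimes> b) \<otimes> b [^] k"
        using u d w car bk by (simp add: m_assoc[symmetric])
      also have "\<dots> = w \<otimes> b [^] Suc k"
        using car b w bk by (simp add: m_assoc nat_pow_comm[of b 1 k, simplified])
      finally show ?case using w by blast
    next
      case (sum s1 s2)
      then obtain u1 u2 where "u1 \<in> I" "s1 = u1 \<otimes> b [^] Suc k"
        "u2 \<in> I" "s2 = u2 \<otimes> b [^] Suc k" by blast
      then show ?case using car b cl by (intro image_eqI[of _ _ "u1 \<oplus> u2"]) (auto simp: l_distr)
    qed
  qed
qed

section \<open>The augmentation ideal over the field with two elements\<close>

locale finite_group = group G for G :: "('a, 'b) monoid_scheme" (structure) +
  assumes finite_carrier: "finite (carrier G)"
begin

sublocale F2: residues 2 "residue_ring 2"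
  by unfold_locales simp_all

sublocale finite_group_ring "residue_ring 2" G
  by unfold_locales (rule finite_carrier)

sublocale A: ring RG
  by (rule ring_RG)

abbreviation plus_RG (infixl \<open>\<boxplus>\<close> 65) where "a \<boxplus> b \<equiv> a \<oplus>\<^bsub>RG\<^esub> b"
abbreviation times_RG (infixl \<open>\<boxtimes>\<close> 70) where "a \<boxtimes> b \<equiv> a \<otimes>\<^bsub>RG\<^esub> b"

text \<open>The element \<open>g - 1\<close>, written with a plus sign since the characteristic is
  two.\<close>

definition dpoint :: "'a \<Rightarrow> 'a \<Rightarrow> int"
  where "dpoint g = point g \<boxplus> \<one>\<^bsub>RG\<^esub>"

section \<open>Arithmetic in characteristic two\<close>

lemma F2_carrier: "carrier (residue_ring 2) = {0, 1}"
  by (auto simp: F2.res_carrier_eq)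

lemma F2_coeff: "f \<in> carrier RG \<Longrightarrow> x \<in> carrier G \<Longrightarrow> f x = 0 \<or> f x = 1"
  using RG_coeff_closed[of f x] by (auto simp: F2_carrier)

lemma RG_add_self [simp]:
  assumes "a \<in> carrier RG"
  shows "a \<boxplus> a = \<zero>\<^bsub>RG\<^esub>"
  unfolding RG_add RG_zero
  using F2_coeff[OF assms] by (intro restrict_ext) (auto simp: F2.res_add_eq F2.res_zero_eq)

lemma RG_minus_self [simp]: "a \<in> carrier RG \<Longrightarrow> \<ominus>\<^bsub>RG\<^esub> a = a"
  by (rule A.minus_equality) simp_all

lemma RG_add_self_left [simp]:
  "a \<in> carrier RG \<Longrightarrow> b \<in> carrier RG \<Longrightarrow> a \<boxplus> (a \<boxplus> b) = b"
  by (simp add: A.a_assoc[symmetric])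

lemma dpoint_closed [simp]: "dpoint g \<in> carrier RG"
  by (simp add: dpoint_def point_closed)

declare point_closed [simp]

lemma dpoint_one [simp]: "dpoint \<one> = \<zero>\<^bsub>RG\<^esub>"
  unfolding dpoint_def RG_one by (rule RG_add_self) simp

text \<open>In this form \<open>h - 1\<close> is multiplied on the left only, so a left ideal
  containing \<open>g - 1\<close> and \<open>h - 1\<close> contains \<open>g h - 1\<close>.\<close>

lemma dpoint_mult:
  assumes "g \<in> carrier G" "h \<in> carrier G"
  shows "dpoint (g \<otimes> h) = point g \<boxtimes> dpoint h \<boxplus> dpoint g"
  using assms by (simp add: dpoint_def A.r_distr point_mult_point A.a_ac)

lemma dpoint_mult':
  assumes "g \<in> carrier G" "h \<in> carrier G"
  shows "dpoint (g \<otimes> h) = dpoint g \<boxtimes> dpoint h \<boxplus> dpoint g \<boxplus> dpoint h"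
  using assms by (simp add: dpoint_def A.r_distr A.l_distr point_mult_point A.a_ac)

text \<open>Induction on the size of the support: nonzero coefficients are 1, so adding
  \<open>point g\<close> for a \<open>g\<close> in the support removes \<open>g\<close> from it, and
  adding it once more restores \<open>f\<close>.\<close>

lemma RG_induct [consumes 1, case_names zero add]:
  assumes "f \<in> carrier RG" "P \<zero>\<^bsub>RG\<^esub>"
    and step: "\<And>a g. a \<in> carrier RG \<Longrightarrow> P a \<Longrightarrow> g \<in> carrier G \<Longrightarrow> P (a \<boxplus> point g)"
  shows "P f"
  using assms(1)
proof (induction "card {x \<in> carrier G. f x \<noteq> 0}" arbitrary: f rule: less_induct)
  case less
  show ?case
  proof (cases "\<exists>g\<in>carrier G. f g \<noteq> 0")
    case False
    then have "f = \<zero>\<^bsub>RG\<^esub>"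
      using less.prems by (intro RG_eqI A.zero_closed) (auto simp: RG_zero F2.res_zero_eq)
    then show ?thesis using assms(2) by simp
  next
    case True
    then obtain g where g: "g \<in> carrier G" "f g \<noteq> 0" by blast
    let ?f = "f \<boxplus> point g"
    have val: "?f x = (if x = g then 0 else f x)" if "x \<in> carrier G" for x
      using that g F2_coeff[OF less.prems that]
      by (auto simp: RG_add point_def F2.res_add_eq F2.res_zero_eq F2.res_one_eq)
    have "{x \<in> carrier G. ?f x \<noteq> 0} = {x \<in> carrier G. f x \<noteq> 0} - {g}"
      using val by (auto split: if_splits)
    then have "{x \<in> carrier G. ?f x \<noteq> 0} \<subset> {x \<in> carrier G. f x \<noteq> 0}"
      using g by blast
    then have "card {x \<in> carrier G. ?f x \<noteq> 0} < card {x \<in> carrier G. f x \<noteq> 0}"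
      using finite_carrier by (intro psubset_card_mono) auto
    then have "P ?f" using less.hyps less.prems by simp
    then have "P (?f \<boxplus> point g)" using step g less.prems by simp
    then show ?thesis using less.prems by (simp add: A.a_assoc)
  qed
qed

text \<open>This is the augmentation ideal: scalars are 0 and 1 and every element is its own
  negative, so adding elements \<open>g - 1\<close> already produces their full linear span.\<close>

inductive_set aug_ideal :: "('a \<Rightarrow> int) set" where
  zero: "\<zero>\<^bsub>RG\<^esub> \<in> aug_ideal"
| add_dpoint: "a \<in> aug_ideal \<Longrightarrow> g \<in> carrier G \<Longrightarrow> a \<boxplus> dpoint g \<in> aug_ideal"

lemma aug_ideal_closed: "a \<in> aug_ideal \<Longrightarrow> a \<in> carrier RG"
  by (induction rule: aug_ideal.induct) auto

lemma aug_ideal_add: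
  assumes "a \<in> aug_ideal" "b \<in> aug_ideal"
  shows "a \<boxplus> b \<in> aug_ideal"
  using assms(2)
proof induction
  case (add_dpoint b g)
  then show ?case
    using assms(1) aug_ideal.add_dpoint[of "a \<boxplus> b" g]
    by (simp add: aug_ideal_closed A.a_assoc)
qed (use assms(1) in \<open>simp add: aug_ideal_closed\<close>)

lemma dpoint_in_aug_ideal: "g \<in> carrier G \<Longrightarrow> dpoint g \<in> aug_ideal"
  using aug_ideal.add_dpoint[OF aug_ideal.zero] by simp

text \<open>The identity \<open>h (g - 1) = (h g - 1) - (h - 1)\<close> handles multiplication by a
  group element, and \<open>RG_induct\<close> extends it to arbitrary \<open>c\<close>.\<close>

lemma left_ideal_aug_ideal: "left_ideal aug_ideal RG"
proof (rule A.left_idealI)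
  fix c a assume c: "c \<in> carrier RG" and a: "a \<in> aug_ideal"
  have pt: "point h \<boxtimes> a \<in> aug_ideal" if h: "h \<in> carrier G" for h
    using a
  proof induction
    case (add_dpoint b g)
    have "point h \<boxtimes> dpoint g = dpoint (h \<otimes> g) \<boxplus> dpoint h"
      using h add_dpoint by (simp add: dpoint_mult A.a_assoc)
    then show ?case
      using add_dpoint h
      by (auto simp: A.r_distr aug_ideal_closed intro!: aug_ideal_add dpoint_in_aug_ideal)
  qed (simp add: aug_ideal.zero)
  show "c \<boxtimes> a \<in> aug_ideal" using c
  proof (induction rule: RG_induct)
    case (add b g)
    then show ?case
      using pt a by (auto simp: A.l_distr aug_ideal_closed intro!: aug_ideal_add)
  qed (use a in \<open>simp add: aug_ideal_closed aug_ideal.zero\<close>)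
qed (auto intro: aug_ideal_closed aug_ideal.zero aug_ideal_add)

text \<open>The mirror image, by \<open>(g - 1) h = (g h - 1) - (h - 1)\<close>. That \<Delta> is
  two-sided is used when \<Delta>\<Delta> is bounded.\<close>

lemma aug_ideal_mult_right:
  assumes "a \<in> aug_ideal" "c \<in> carrier RG"
  shows "a \<boxtimes> c \<in> aug_ideal"
proof -
  have pt: "a \<boxtimes> point h \<in> aug_ideal" if h: "h \<in> carrier G" for h
    using assms(1)
  proof induction
    case (add_dpoint b g)
    have "dpoint g \<boxtimes> point h = dpoint (g \<otimes> h) \<boxplus> dpoint h"
      using h add_dpoint by (simp add: dpoint_def A.l_distr point_mult_point A.a_ac)
    then show ?case
      using add_dpoint h
      by (auto simp: A.l_distr aug_ideal_closed intro!: aug_ideal_add dpoint_in_aug_ideal)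
  qed (simp add: aug_ideal.zero)
  show ?thesis using assms(2)
  proof (induction rule: RG_induct)
    case (add b g)
    then show ?case
      using pt assms(1) by (auto simp: A.r_distr aug_ideal_closed intro!: aug_ideal_add)
  qed (use assms(1) in \<open>simp add: aug_ideal_closed aug_ideal.zero\<close>)
qed

lemma aug_ideal_subset_left_ideal:
  assumes K: "left_ideal K RG" and "\<And>g. g \<in> carrier G \<Longrightarrow> dpoint g \<in> K"
  shows "aug_ideal \<subseteq> K"
proof
  fix a assume "a \<in> aug_ideal"
  then show "a \<in> K"
    by induction (use assms A.left_ideal_closed[OF K] in auto)
qed

text \<open>Adding a group element \<open>g = 1 + (g - 1)\<close> exchanges the two alternatives.
  This supplies the hypothesis \<open>loc\<close> of \<open>jacobson_radical_eqI\<close>.\<close>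

lemma aug_ideal_dichotomy:
  assumes "a \<in> carrier RG"
  shows "a \<in> aug_ideal \<or> \<one>\<^bsub>RG\<^esub> \<ominus>\<^bsub>RG\<^esub> a \<in> aug_ideal"
  using assms
proof (induction rule: RG_induct)
  case (add b g)
  have "\<one>\<^bsub>RG\<^esub> \<ominus>\<^bsub>RG\<^esub> (b \<boxplus> point g) = b \<boxplus> dpoint g"
    using add by (simp add: a_minus_def dpoint_def A.a_ac)
  moreover have "b \<boxplus> point g = (\<one>\<^bsub>RG\<^esub> \<ominus>\<^bsub>RG\<^esub> b) \<boxplus> dpoint g"
    using add by (simp add: a_minus_def dpoint_def A.a_ac)
  ultimately show ?case using add aug_ideal.add_dpoint by metis
qed (simp add: aug_ideal.zero)

text \<open>Products are covered by \<open>dpoint_mult\<close>. For inverses, the same expansion of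
  \<open>inv g \<otimes> g\<close>, whose \<open>dpoint\<close> is zero, expresses
  \<open>dpoint (inv g)\<close> as a left multiple of \<open>dpoint g\<close>.\<close>

lemma subgroup_dpoint_in_left_ideal:
  assumes K: "left_ideal K RG"
  shows "subgroup {g \<in> carrier G. dpoint g \<in> K} G"
proof (rule subgroupI)
  note cl = A.left_ideal_closed[OF K]
  have "\<one> \<in> {g \<in> carrier G. dpoint g \<in> K}" using cl by simp
  then show "{g \<in> carrier G. dpoint g \<in> K} \<noteq> {}" by blast
  fix g assume g: "g \<in> {g \<in> carrier G. dpoint g \<in> K}"
  have "point (inv g) \<boxtimes> dpoint g \<boxplus> dpoint (inv g) = dpoint (inv g \<otimes> g)"
    using g by (intro dpoint_mult[symmetric]) auto
  also have "\<dots> = \<zero>\<^bsub>RG\<^esub>" using g by simp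
  finally have "dpoint (inv g) = point (inv g) \<boxtimes> dpoint g"
    using g A.minus_equality[of "point (inv g) \<boxtimes> dpoint g" "dpoint (inv g)"] by simp
  then show "inv g \<in> {g \<in> carrier G. dpoint g \<in> K}" using g cl by simp
  fix h assume h: "h \<in> {g \<in> carrier G. dpoint g \<in> K}"
  show "g \<otimes> h \<in> {g \<in> carrier G. dpoint g \<in> K}"
    using g h cl by (simp add: dpoint_mult)
qed auto

section \<open>Generators and the nilpotency of \<Delta>\<close>

lemma aug_ideal_subset_of_generators:
  assumes K: "left_ideal K RG" and xy: "x \<in> carrier G" "y \<in> carrier G"
    and gen: "\<And>H. subgroup H G \<Longrightarrow> x \<in> H \<Longrightarrow> y \<in> H \<Longrightarrow> H = carrier G"
    and "dpoint x \<in> K" "dpoint y \<in> K"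
  shows "aug_ideal \<subseteq> K"
proof -
  have "{g \<in> carrier G. dpoint g \<in> K} = carrier G"
    by (rule gen) (use assms subgroup_dpoint_in_left_ideal in auto)
  then show ?thesis by (intro aug_ideal_subset_left_ideal[OF K]) auto
qed

text \<open>Iterated squaring in characteristic two: the two linear terms of
  \<open>dpoint_mult'\<close> cancel, so \<open>(h - 1)^2 = h^2 - 1\<close>.\<close>

lemma dpoint_two_power:
  assumes "g \<in> carrier G"
  shows "dpoint g [^]\<^bsub>RG\<^esub> ((2::nat) ^ k) = dpoint (g [^] ((2::nat) ^ k))"
proof (induction k)
  case (Suc k)
  let ?h = "g [^] ((2::nat) ^ k)"
  have "dpoint g [^]\<^bsub>RG\<^esub> ((2::nat) ^ Suc k) = dpoint ?h \<boxtimes> dpoint ?h"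
    by (simp add: Suc.IH[symmetric] A.nat_pow_mult mult_2)
  also have "\<dots> = dpoint (?h \<otimes> ?h)"
    using assms by (simp add: dpoint_mult' A.a_assoc)
  finally show ?case using assms by (simp add: nat_pow_mult mult_2)
qed (use assms in simp)

text \<open>The relations place \<open>x^2\<close> and the commutator of \<open>x\<close> and
  \<open>y\<close> in the subgroup generated by \<open>y^2\<close>, and
  \<open>y^2 - 1 = (y - 1)^2\<close> lies in \<open>\<Delta>(y - 1)\<close>. This forces
  \<Delta>\<Delta> into \<open>\<Delta>(y - 1)\<close>, and
  \<open>(y - 1)^(2^m) = y^(2^m) - 1 = 0\<close> ends the chain of powers.\<close>

lemma aug_ideal_pow_eq_zero:
  assumes x: "x \<in> carrier G" and y: "y \<in> carrier G"
    and gen: "\<And>H. subgroup H G \<Longrightarrow> x \<in> H \<Longrightarrow> y \<in> H \<Longrightarrow> H = carrier G"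
    and xx: "x \<otimes> x = (y \<otimes> y) [^] (i::int)"
    and yx: "y \<otimes> x = x \<otimes> y \<otimes> (y \<otimes> y) [^] (j::int)"
    and yn: "y [^] ((2::nat) ^ m) = \<one>"
  shows "ideal_pow RG aug_ideal (Suc (2 ^ m)) = {\<zero>\<^bsub>RG\<^esub>}"
proof -
  define K where "K = (\<lambda>c. c \<boxtimes> dpoint y) ` aug_ideal"
  note aug = A.left_ideal_closed[OF left_ideal_aug_ideal]
  have K: "left_ideal K RG"
  proof (rule A.left_idealI)
    show "K \<subseteq> carrier RG" by (auto simp: K_def aug_ideal_closed)
    show "\<zero>\<^bsub>RG\<^esub> \<in> K"
      unfolding K_def by (rule image_eqI[OF _ aug_ideal.zero]) simp
    fix a b assume a: "a \<in> K"
    then obtain u where u: "a = u \<boxtimes> dpoint y" "u \<in> aug_ideal" by (auto simp: K_def)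
    {
      assume "b \<in> K"
      then obtain v where "b = v \<boxtimes> dpoint y" "v \<in> aug_ideal" by (auto simp: K_def)
      then show "a \<boxplus> b \<in> K" using u unfolding K_def
        by (intro image_eqI[of _ _ "u \<boxplus> v"]) (auto simp: A.l_distr aug_ideal_closed aug)
    }
    fix c assume "c \<in> carrier RG"
    then show "c \<boxtimes> a \<in> K" using u unfolding K_def
      by (intro image_eqI[of _ _ "c \<boxtimes> u"]) (auto simp: A.m_assoc aug_ideal_closed aug)
  qed
  note Kcl = A.left_ideal_closed[OF K]
  have KY: "a \<boxtimes> dpoint y \<in> K" if "a \<in> aug_ideal" for a
    using that by (simp add: K_def)
  have "dpoint (y \<otimes> y) = dpoint y \<boxtimes> dpoint y"
    using y by (simp add: dpoint_mult' A.a_assoc)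
  then have "dpoint (y \<otimes> y) \<in> K"
    using KY dpoint_in_aug_ideal y by simp
  then have even: "dpoint ((y \<otimes> y) [^] (k::int)) \<in> K" for k
    using subgroup_int_pow_closed[OF subgroup_dpoint_in_left_ideal[OF K], of "y \<otimes> y" k] y by simp
  have XX: "dpoint x \<boxtimes> dpoint x \<in> K"
  proof -
    have "dpoint x \<boxtimes> dpoint x = dpoint (x \<otimes> x)"
      using x by (simp add: dpoint_mult' A.a_assoc)
    then show ?thesis using even xx by simp
  qed
  have YX: "dpoint y \<boxtimes> dpoint x \<in> K"
  proof -
    define w where "w = (y \<otimes> y) [^] j"
    have w: "w \<in> carrier G" "dpoint w \<in> K" using y even by (simp_all add: w_def)
    have "dpoint y \<boxtimes> dpoint x = dpoint (y \<otimes> x) \<boxplus> dpoint x \<boxplus> dpoint y"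
      using x y by (simp add: dpoint_mult' A.a_ac)
    \<comment> \<open>As \<open>y x = x y w\<close>, the element \<open>y x - 1\<close> is
      \<open>x y (w - 1) + (x y - 1)\<close>. After the linear terms cancel,
      \<open>(x - 1) (y - 1)\<close> remains besides the multiple of \<open>w - 1\<close>, and both
      lie in \<open>K\<close>.\<close>
    also have "dpoint (y \<otimes> x) =
        point (x \<otimes> y) \<boxtimes> dpoint w \<boxplus> (dpoint x \<boxtimes> dpoint y \<boxplus> dpoint x \<boxplus> dpoint y)"
      using x y w by (simp only: yx w_def[symmetric] dpoint_mult[of "x \<otimes> y" w] dpoint_mult'[of x y] m_closed)
    also have "\<dots> \<boxplus> dpoint x \<boxplus> dpoint y = point (x \<otimes> y) \<boxtimes> dpoint w \<boxplus> dpoint x \<boxtimes> dpoint y"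
      using x y by (simp add: A.a_ac)
    finally show ?thesis using w x KY dpoint_in_aug_ideal Kcl by simp
  qed
  \<comment> \<open>Generators are inserted one factor at a time. \<open>U\<close> holds the left
    factors that send \<open>x - 1\<close> into \<open>K\<close>; it contains \<open>x - 1\<close>
    and \<open>y - 1\<close>, hence \<Delta>.\<close>
  define U where "U = {a \<in> carrier RG. a \<boxtimes> dpoint x \<in> K}"
  have "left_ideal U RG"
    by (rule A.left_idealI) (auto simp: U_def A.l_distr A.m_assoc Kcl)
  then have "aug_ideal \<subseteq> U"
    by (rule aug_ideal_subset_of_generators[OF _ x y gen]) (auto simp: U_def XX YX)
  then have KX: "a \<boxtimes> dpoint x \<in> K" if "a \<in> aug_ideal" for a
    using that by (auto simp: U_def)
  \<comment> \<open>Now the right factor. \<open>V\<close> is a left ideal because a coefficient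
    \<open>c\<close> can be absorbed into the left factor \<open>a\<close>, \<Delta> being closed
    under right multiplication.\<close>
  define V where "V = {b \<in> carrier RG. \<forall>a\<in>aug_ideal. a \<boxtimes> b \<in> K}"
  have "left_ideal V RG"
  proof (rule A.left_idealI)
    fix c b assume c: "c \<in> carrier RG" and b: "b \<in> V"
    have "a \<boxtimes> (c \<boxtimes> b) \<in> K" if "a \<in> aug_ideal" for a
    proof -
      have "a \<boxtimes> (c \<boxtimes> b) = (a \<boxtimes> c) \<boxtimes> b"
        using that c b by (simp add: A.m_assoc aug_ideal_closed V_def)
      then show ?thesis using aug_ideal_mult_right[OF that c] b by (simp add: V_def)
    qed
    then show "c \<boxtimes> b \<in> V" using c b by (auto simp: V_def)
  qed (auto simp: V_def A.r_distr Kcl aug_ideal_closed)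
  then have "aug_ideal \<subseteq> V"
    by (rule aug_ideal_subset_of_generators[OF _ x y gen]) (auto simp: V_def KX KY)
  then have "a \<boxtimes> c \<in> K" if "a \<in> aug_ideal" "c \<in> aug_ideal" for a c
    using that by (auto simp: V_def)
  then have sq: "\<exists>d\<in>aug_ideal. a \<boxtimes> c = d \<boxtimes> dpoint y"
    if "a \<in> aug_ideal" "c \<in> aug_ideal" for a c
    using that by (auto simp: K_def)
  have "ideal_pow RG aug_ideal (Suc (2 ^ m)) \<subseteq>
      (\<lambda>a. a \<boxtimes> dpoint y [^]\<^bsub>RG\<^esub> ((2::nat) ^ m)) ` aug_ideal"
    using sq y by (intro A.ideal_pow_subset_right_multiples left_ideal_aug_ideal)
      (auto intro: dpoint_in_aug_ideal)
  also have "\<dots> \<subseteq> {\<zero>\<^bsub>RG\<^esub>}"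
    using y yn by (auto simp: dpoint_two_power aug_ideal_closed)
  finally show ?thesis
    using A.zero_in_ideal_pow[OF aug_ideal.zero, of "Suc (2 ^ m)"] by blast
qed

lemma jacobson_radical_eq_aug_ideal:
  assumes "ideal_pow RG aug_ideal N = {\<zero>\<^bsub>RG\<^esub>}"
  shows "jacobson_radical RG = aug_ideal"
proof (rule A.jacobson_radical_eqI[OF left_ideal_aug_ideal])
  have nil: "u [^]\<^bsub>RG\<^esub> N = \<zero>\<^bsub>RG\<^esub>" if "u \<in> aug_ideal" for u
    using A.nat_pow_in_ideal_pow[OF that, of N] assms aug_ideal_closed by blast
  then show "\<exists>k::nat. u [^]\<^bsub>RG\<^esub> k = \<zero>\<^bsub>RG\<^esub>" if "u \<in> aug_ideal" for u
    using that by blast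
  have "\<one>\<^bsub>RG\<^esub> \<noteq> \<zero>\<^bsub>RG\<^esub>"
  proof
    assume "\<one>\<^bsub>RG\<^esub> = \<zero>\<^bsub>RG\<^esub>"
    then have "\<one>\<^bsub>RG\<^esub> \<one> = \<zero>\<^bsub>RG\<^esub> \<one>" by simp
    then show False by (simp add: RG_one RG_zero point_def F2.res_one_eq F2.res_zero_eq)
  qed
  \<comment> \<open>An idempotent that is nilpotent vanishes, so \<open>\<one>\<close> cannot lie in
    \<Delta>.\<close>
  then show "\<one>\<^bsub>RG\<^esub> \<notin> aug_ideal" using nil by fastforce
qed (rule aug_ideal_dichotomy)

end

section \<open>Ordered subproducts and the group ring\<close>

text \<open>Sublists replace index sets so that products can be treated by induction from the right
  end of the list.\<close>

lemma has_ordered_one_product_iff_subseq: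
  "has_ordered_one_product G gs \<longleftrightarrow>
    (\<exists>ys. subseq ys gs \<and> ys \<noteq> [] \<and> foldr (\<otimes>\<^bsub>G\<^esub>) ys \<one>\<^bsub>G\<^esub> = \<one>\<^bsub>G\<^esub>)"
proof
  assume "has_ordered_one_product G gs"
  then obtain I where I: "I \<noteq> {}" "I \<subseteq> {..<length gs}"
      "foldr (\<otimes>\<^bsub>G\<^esub>) (nths gs I) \<one>\<^bsub>G\<^esub> = \<one>\<^bsub>G\<^esub>"
    by (auto simp: has_ordered_one_product_def)
  have "set (nths gs I) \<noteq> {}" using I by (auto simp: set_nths)
  then have "nths gs I \<noteq> []" by auto
  then show "\<exists>ys. subseq ys gs \<and> ys \<noteq> [] \<and> foldr (\<otimes>\<^bsub>G\<^esub>) ys \<one>\<^bsub>G\<^esub> = \<one>\<^bsub>G\<^esub>"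
    using I by (auto simp: subseq_conv_nths)
next
  assume "\<exists>ys. subseq ys gs \<and> ys \<noteq> [] \<and> foldr (\<otimes>\<^bsub>G\<^esub>) ys \<one>\<^bsub>G\<^esub> = \<one>\<^bsub>G\<^esub>"
  then obtain I where I: "nths gs I \<noteq> []"
      "foldr (\<otimes>\<^bsub>G\<^esub>) (nths gs I) \<one>\<^bsub>G\<^esub> = \<one>\<^bsub>G\<^esub>"
    by (auto simp: subseq_conv_nths)
  \<comment> \<open>The index set given by \<open>subseq_conv_nths\<close> may exceed the length;
    cutting it off leaves the selected sublist unchanged.\<close>
  let ?J = "I \<inter> {..<length gs}"
  have eq: "nths gs ?J = nths gs I"
    unfolding nths_def by (rule arg_cong[where f = "map fst"], rule filter_cong)
      (auto dest: set_zip_rightD)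
  moreover have "?J \<noteq> {}"
  proof
    assume "?J = {}"
    then show False using eq I by simp
  qed
  ultimately show "has_ordered_one_product G gs"
    unfolding has_ordered_one_product_def using I by (intro exI[of _ ?J]) auto
qed

lemma (in monoid) foldr_mult_closed:
  "set gs \<subseteq> carrier G \<Longrightarrow> foldr (\<otimes>) gs \<one> \<in> carrier G"
  by (induction gs) auto

lemma (in monoid) foldr_mult_append:
  "set gs \<subseteq> carrier G \<Longrightarrow> set hs \<subseteq> carrier G \<Longrightarrow>
    foldr (\<otimes>) (gs @ hs) \<one> = foldr (\<otimes>) gs \<one> \<otimes> foldr (\<otimes>) hs \<one>"
  by (induction gs) (auto simp: foldr_mult_closed m_assoc)

lemma (in monoid) foldr_mult_replicate:
  "y \<in> carrier G \<Longrightarrow> foldr (\<otimes>) (replicate k y) \<one> = y [^] (k::nat)"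
  by (induction k) (simp_all, metis nat_pow_Suc nat_pow_Suc2)

context finite_group
begin

text \<open>The product \<open>(g_1 - 1) ... (g_k - 1)\<close>, associated to the left because
  \<open>ideal_pow\<close> also appends its factors on the right.\<close>

abbreviation dpoint_prod :: "'a list \<Rightarrow> 'a \<Rightarrow> int"
  where "dpoint_prod gs \<equiv> foldl (\<lambda>a g. a \<boxtimes> dpoint g) \<one>\<^bsub>RG\<^esub> gs"

lemma dpoint_prod_closed: "dpoint_prod gs \<in> carrier RG"
  by (induction gs rule: rev_induct) auto

lemma dpoint_prod_in_ideal_pow:
  "set gs \<subseteq> carrier G \<Longrightarrow> dpoint_prod gs \<in> ideal_pow RG aug_ideal (length gs)"
  by (induction gs rule: rev_induct) (auto intro: ideal_prod.prod dpoint_in_aug_ideal)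

text \<open>With \<open>P\<close> the product over \<open>gs\<close>, this is
  \<open>P (g - 1) = P g - P\<close> read off at \<open>z\<close>: right multiplication by
  \<open>g\<close> shifts coefficients.\<close>

lemma dpoint_prod_snoc:
  assumes "g \<in> carrier G" "z \<in> carrier G"
  shows "dpoint_prod (gs @ [g]) z = (dpoint_prod gs (z \<otimes> inv g) + dpoint_prod gs z) mod 2"
proof -
  have "dpoint_prod (gs @ [g]) = dpoint_prod gs \<boxtimes> point g \<boxplus> dpoint_prod gs"
    using dpoint_prod_closed by (simp add: dpoint_def A.r_distr)
  then show ?thesis
    using assms dpoint_prod_closed by (simp add: RG_add F2.res_add_eq mult_point)
qed

text \<open>Expanding the product yields only ordered subproducts of \<open>gs\<close>, the empty
  one included: a new factor \<open>g\<close> either leaves such a subproduct alone or is appended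
  to it.\<close>

lemma dpoint_prod_support:
  assumes "set gs \<subseteq> carrier G" "z \<in> carrier G" "dpoint_prod gs z \<noteq> 0"
  shows "\<exists>ys. subseq ys gs \<and> z = foldr (\<otimes>) ys \<one>"
  using assms
proof (induction gs arbitrary: z rule: rev_induct)
  case Nil
  then show ?case
    by (auto simp: RG_one point_def F2.res_one_eq F2.res_zero_eq split: if_splits)
next
  case (snoc g gs)
  have g: "g \<in> carrier G" "set gs \<subseteq> carrier G" using snoc.prems by auto
  have "\<not> (dpoint_prod gs (z \<otimes> inv g) = 0 \<and> dpoint_prod gs z = 0)"
    using snoc.prems g by (auto simp: dpoint_prod_snoc simp del: foldl_append)
  then consider "dpoint_prod gs (z \<otimes> inv g) \<noteq> 0" | "dpoint_prod gs z \<noteq> 0"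
    by blast
  then show ?case
  proof cases
    case 1
    then obtain ys where ys: "subseq ys gs" "z \<otimes> inv g = foldr (\<otimes>) ys \<one>"
      using snoc.IH[of "z \<otimes> inv g"] snoc.prems g by auto
    have "set ys \<subseteq> carrier G" using ys(1) g(2) by (auto dest: list_emb_set)
    moreover have "z = (z \<otimes> inv g) \<otimes> g" using snoc.prems g by (simp add: m_assoc)
    ultimately have "z = foldr (\<otimes>) (ys @ [g]) \<one>"
      using g ys by (subst foldr_mult_append) auto
    moreover have "subseq (ys @ [g]) (gs @ [g])" using ys by simp
    ultimately show ?thesis by blast
  next
    case 2
    then show ?thesis using snoc.IH[of z] snoc.prems g by (meson subseq_rev_drop_many)
  qed
qed

text \<open>The empty subproduct contributes 1. A new factor \<open>g\<close> adds the coefficient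
  at \<open>inv g\<close>, which vanishes: an ordered subproduct equal to \<open>inv g\<close>,
  followed by \<open>g\<close>, would be a nonempty one equal to \<open>\<one>\<close>.\<close>

lemma dpoint_prod_one:
  assumes "set gs \<subseteq> carrier G" "\<not> has_ordered_one_product G gs"
  shows "dpoint_prod gs \<one> = 1"
  using assms
proof (induction gs rule: rev_induct)
  case Nil
  then show ?case by (simp add: RG_one point_def F2.res_one_eq)
next
  case (snoc g gs)
  have g: "g \<in> carrier G" "set gs \<subseteq> carrier G" using snoc.prems by auto
  have "\<not> has_ordered_one_product G gs"
    using snoc.prems(2) by (auto simp: has_ordered_one_product_iff_subseq intro: subseq_rev_drop_many)
  then have one: "dpoint_prod gs \<one> = 1" using snoc.IH g by blast
  have "dpoint_prod gs (\<one> \<otimes> inv g) = 0"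
  proof (rule ccontr)
    assume "dpoint_prod gs (\<one> \<otimes> inv g) \<noteq> 0"
    then obtain ys where ys: "subseq ys gs" "inv g = foldr (\<otimes>) ys \<one>"
      using dpoint_prod_support[of gs "inv g"] g by auto
    have "set ys \<subseteq> carrier G" using ys(1) g(2) by (auto dest: list_emb_set)
    then have "foldr (\<otimes>) (ys @ [g]) \<one> = \<one>"
      using g by (subst foldr_mult_append) (auto simp: ys(2)[symmetric])
    moreover have "subseq (ys @ [g]) (gs @ [g])" using ys by simp
    ultimately show False
      using snoc.prems(2) unfolding has_ordered_one_product_iff_subseq by blast
  qed
  then show ?case using one g by (simp add: dpoint_prod_snoc del: foldl_append)
qed

section \<open>Comparison of the two invariants\<close>

lemma ideal_pow_zero_imp_ordered_one_product:
  assumes "ideal_pow RG aug_ideal (length gs) = {\<zero>\<^bsub>RG\<^esub>}" "set gs \<subseteq> carrier G"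
  shows "has_ordered_one_product G gs"
proof (rule ccontr)
  assume "\<not> has_ordered_one_product G gs"
  then have "dpoint_prod gs \<one> = 1" using dpoint_prod_one assms by blast
  moreover have "dpoint_prod gs = \<zero>\<^bsub>RG\<^esub>" using dpoint_prod_in_ideal_pow assms by blast
  ultimately show False by (simp add: RG_zero F2.res_zero_eq)
qed

text \<open>The squeeze \<open>N < D \<le> L \<le> Suc N\<close>. The hypothesis \<open>free\<close>
  covers every positive length up to \<open>N\<close>, so it can be applied at the minimum
  \<open>D\<close> itself.\<close>

lemma ordered_davenport_eq_loewy_length_F2I:
  assumes zero: "ideal_pow RG aug_ideal (Suc N) = {\<zero>\<^bsub>RG\<^esub>}"
    and free: "\<And>k. 0 < k \<Longrightarrow> k \<le> N \<Longrightarrow>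
      \<exists>gs. length gs = k \<and> set gs \<subseteq> carrier G \<and> \<not> has_ordered_one_product G gs"
  shows "ordered_davenport G = loewy_length_F2 G"
proof -
  let ?P = "\<lambda>k. 0 < k \<and>
    (\<forall>gs. length gs = k \<and> set gs \<subseteq> carrier G \<longrightarrow> has_ordered_one_product G gs)"
  define L where "L = (LEAST k. ideal_pow RG aug_ideal k = {\<zero>\<^bsub>RG\<^esub>})"
  have L: "loewy_length_F2 G = L"
    unfolding loewy_length_F2_def loewy_length_def L_def jacobson_radical_eq_aug_ideal[OF zero] ..
  have "L \<le> Suc N" unfolding L_def using zero by (rule Least_le)
  have Lz: "ideal_pow RG aug_ideal L = {\<zero>\<^bsub>RG\<^esub>}" unfolding L_def using zero by (rule LeastI)
  \<comment> \<open>Positivity is part of the condition in \<open>ordered_davenport\<close>; here it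
    holds because the power with exponent 0 is the whole ring, which is nonzero.\<close>
  have "L \<noteq> 0"
  proof
    assume "L = 0"
    then have "\<one>\<^bsub>RG\<^esub> = \<zero>\<^bsub>RG\<^esub>" using Lz A.one_closed by auto
    then have "\<one>\<^bsub>RG\<^esub> \<one> = \<zero>\<^bsub>RG\<^esub> \<one>" by simp
    then show False by (simp add: RG_one RG_zero point_def F2.res_one_eq F2.res_zero_eq)
  qed
  then have PL: "?P L" using Lz ideal_pow_zero_imp_ordered_one_product by auto
  define D where "D = ordered_davenport G"
  have "D \<le> L" unfolding D_def ordered_davenport_def using PL by (rule Least_le)
  have PD: "?P D" unfolding D_def ordered_davenport_def using PL by (rule LeastI)
  have "\<not> D \<le> N"
  proof
    assume "D \<le> N"
    then obtain gs where "length gs = D" "set gs \<subseteq> carrier G" "\<not> has_ordered_one_product G gs"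
      using free[of D] PD by blast
    then show False using PD by blast
  qed
  then show ?thesis
    using \<open>L \<le> Suc N\<close> \<open>D \<le> L\<close> L D_def by simp
qed

text \<open>A nonempty ordered subproduct is \<open>y^j\<close> with
  \<open>0 < j \<le> k < n\<close>, excluded by \<open>ord\<close>, or \<open>y^j x\<close>,
  excluded by \<open>notin\<close>. The list has length \<open>k + 1\<close>, so all lengths from 1
  to \<open>n\<close> are reached.\<close>

lemma replicate_snoc_no_ordered_one_product:
  assumes x: "x \<in> carrier G" and y: "y \<in> carrier G"
    and ord: "\<And>k::nat. 0 < k \<Longrightarrow> k < n \<Longrightarrow> y [^] k \<noteq> \<one>"
    and notin: "\<And>k::nat. y [^] k \<otimes> x \<noteq> \<one>"
    and k: "k < n"
  shows "\<not> has_ordered_one_product G (replicate k y @ [x])"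
proof
  assume "has_ordered_one_product G (replicate k y @ [x])"
  then obtain ys where ys: "subseq ys (replicate k y @ [x])" "ys \<noteq> []" "foldr (\<otimes>) ys \<one> = \<one>"
    by (auto simp: has_ordered_one_product_iff_subseq)
  from ys(1) obtain us vs where uv: "ys = us @ vs" "subseq us (replicate k y)" "subseq vs [x]"
    by (rule subseq_appendE)
  define j where "j = length us"
  have j: "j \<le> k" using uv(2) by (auto simp: j_def dest: list_emb_length)
  have "z = y" if "z \<in> set us" for z
    using list_emb_set[OF uv(2) that] by auto
  then have us: "us = replicate j y"
    by (intro replicate_eqI) (simp_all add: j_def)
  have vs: "vs = [] \<or> vs = [x]"
    using uv(3) by (cases vs) (auto split: if_splits)
  have "foldr (\<otimes>) ys \<one> = y [^] j \<otimes> foldr (\<otimes>) vs \<one>"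
    using uv us vs x y by (subst uv(1), subst foldr_mult_append) (auto simp: foldr_mult_replicate simp del: foldr_replicate)
  then show False
    using vs ys uv us notin[of j] ord[of j] j k x y by (cases j) auto
qed

lemma ordered_davenport_eq_loewy_length_F2_metacyclic:
  assumes x: "x \<in> carrier G" and y: "y \<in> carrier G"
    and gen: "\<And>H. subgroup H G \<Longrightarrow> x \<in> H \<Longrightarrow> y \<in> H \<Longrightarrow> H = carrier G"
    and xx: "x \<otimes> x = (y \<otimes> y) [^] (i::int)"
    and yx: "y \<otimes> x = x \<otimes> y \<otimes> (y \<otimes> y) [^] (j::int)"
    and yn: "y [^] ((2::nat) ^ m) = \<one>"
    and ord: "\<And>k::nat. 0 < k \<Longrightarrow> k < 2 ^ m \<Longrightarrow> y [^] k \<noteq> \<one>"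
    and notin: "\<And>k::nat. y [^] k \<otimes> x \<noteq> \<one>"
  shows "ordered_davenport G = loewy_length_F2 G"
proof (rule ordered_davenport_eq_loewy_length_F2I)
  show "ideal_pow RG aug_ideal (Suc (2 ^ m)) = {\<zero>\<^bsub>RG\<^esub>}"
    using x y gen xx yx yn by (rule aug_ideal_pow_eq_zero)
  fix k :: nat assume "0 < k" "k \<le> 2 ^ m"
  then show "\<exists>gs. length gs = k \<and> set gs \<subseteq> carrier G \<and> \<not> has_ordered_one_product G gs"
    using x y replicate_snoc_no_ordered_one_product[OF x y ord notin, of "2 ^ m" "k - 1"]
    by (intro exI[of _ "replicate (k - 1) y @ [x]"]) auto
qed

end

section \<open>Groups with two generators given by metacyclic relations\<close>

text \<open>Integer exponents let one family of relations cover all four presentations.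
  \<open>ypow 0\<close> is the empty word and \<open>ypow (- 1)\<close> is
  \<open>word_inv wy\<close>, so the relators agree with the given ones as words.\<close>

definition ypow :: "int \<Rightarrow> xy word"
  where "ypow k = (if 0 \<le> k then word_pow wy (nat k) else word_inv (word_pow wy (nat (- k))))"

definition metacyclic_rels :: "nat \<Rightarrow> int \<Rightarrow> int \<Rightarrow> (xy word \<times> xy word) set"
  where "metacyclic_rels n e c =
    {(word_pow wx 2, ypow e), (word_pow wy n, []), (word_inv wx @ wy @ wx, ypow c)}"

text \<open>
  The pair \<open>(s, b)\<close> stands for the normal form \<open>x\<^sup>s y\<^sup>b\<close>, with \<open>b\<close> read modulo \<open>n\<close>;
  a letter acts on it by right multiplication.
\<close>

fun letter_act :: "int \<Rightarrow> int \<Rightarrow> int \<Rightarrow> xy \<times> bool \<Rightarrow> bool \<times> int \<Rightarrow> bool \<times> int" where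
  "letter_act n e c (GenY, t) (s, b) = (s, (if t then b + 1 else b - 1) mod n)"
| "letter_act n e c (GenX, t) (s, b) =
    (\<not> s, (c * b + (if s then if t then e else 0 else if t then 0 else - e)) mod n)"

abbreviation word_act :: "int \<Rightarrow> int \<Rightarrow> int \<Rightarrow> xy word \<Rightarrow> bool \<times> int \<Rightarrow> bool \<times> int"
  where "word_act n e c \<equiv> fold (letter_act n e c)"

section \<open>The action of words on normal forms\<close>

lemma word_pow_word_gen: "word_pow (word_gen a) k = replicate k (a, True)"
  by (induction k) (auto simp: word_pow_def word_gen_def)

lemma ypow_replicate: "ypow k = replicate (nat \<bar>k\<bar>) (GenY, 0 \<le> k)"
  by (auto simp: ypow_def word_pow_word_gen word_inv_def)

lemma word_act_replicate_GenY:
  "b mod n = b \<Longrightarrow> word_act n e c (replicate k (GenY, t)) (s, b) =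
    (s, (if t then b + int k else b - int k) mod n)"
proof (induction k arbitrary: b)
  case (Suc k)
  have "(if t then b + 1 else b - 1) mod n mod n = (if t then b + 1 else b - 1) mod n" by simp
  from Suc.IH[OF this] show ?case
    by (auto simp: mod_simps algebra_simps)
qed auto

lemma word_act_ypow: "b mod n = b \<Longrightarrow> word_act n e c (ypow k) (s, b) = (s, (b + k) mod n)"
  by (auto simp: ypow_replicate word_act_replicate_GenY simp del: fold_replicate)

lemma letter_act_mod: "snd (letter_act n e c l sb) mod n = snd (letter_act n e c l sb)"
  by (cases l; cases sb; cases "fst l") auto

lemma word_act_mod: "snd sb mod n = snd sb \<Longrightarrow> snd (word_act n e c w sb) mod n = snd (word_act n e c w sb)"
  by (induction w arbitrary: sb) (auto simp: letter_act_mod)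

text \<open>A power \<open>y^b\<close> passes \<open>x\<close> or its inverse by multiplying
  \<open>b\<close> with \<open>c\<close>, and \<open>e\<close> enters when \<open>x^2\<close> is
  replaced by \<open>y^e\<close>. Modulo \<open>n\<close>, the two divisibility conditions say that
  multiplication by \<open>c\<close> is an involution and fixes \<open>e\<close>; this makes the
  action respect the relations.\<close>

lemma word_eq_imp_word_act_eq:
  assumes cc: "n dvd c * c - 1" and ce: "n dvd c * e - e"
    and "word_eq (metacyclic_rels m e c) u v" and n: "n = int m"
    and "snd sb mod n = snd sb"
  shows "word_act n e c u sb = word_act n e c v sb"
proof -
  obtain p where "c * c - 1 = n * p" using cc by (rule dvdE)
  then have p: "c * c = 1 + n * p" by simp
  obtain q where "c * e - e = n * q" using ce by (rule dvdE)
  then have q: "c * e = e + n * q" by simp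
  have modI: "i mod n = j mod n" if "i - j = n * k" for i j k
    using that by (metis dvd_triv_left mod_eq_dvd_iff)
  have ccz: "c * (c * z) = z + n * (p * z)" for z
    by (simp only: mult.assoc[symmetric] p) (simp add: algebra_simps)
  \<comment> \<open>Facts 1 to 7 are the exponent identities for the cases on \<open>s\<close>: 1, 4
    and 5 serve cancellation, 2 and 3 the relation for \<open>x^2\<close>, 6 and 7 the conjugation
    relation.\<close>
  have 1: "(c * (c * b)) mod n = b mod n" for b
    by (rule modI[of _ _ "p * b"]) (simp add: distrib_left right_diff_distrib ccz q)
  have 2: "(c * (c * b mod n) + e) mod n = (b + e) mod n" for b
    by (metis 1 mod_add_left_eq mod_mult_right_eq)
  have 3: "(c * (c * b + e)) mod n = (b + e) mod n" for b
    by (rule modI[of _ _ "p * b + q"]) (simp add: distrib_left right_diff_distrib ccz q)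
  have "(c * (c * b + e) - e) mod n = b mod n" for b
    by (rule modI[of _ _ "p * b + q"]) (simp add: distrib_left ccz q)
  then have 4: "(c * ((c * b + e) mod n) - e) mod n = b mod n" for b
    by (metis mod_diff_left_eq mod_mult_right_eq)
  have "(c * (c * b - e) + e) mod n = b mod n" for b
    by (rule modI[of _ _ "p * b - q"]) (simp add: distrib_left right_diff_distrib ccz q)
  then have 5: "(c * ((c * b - e) mod n) + e) mod n = b mod n" for b
    by (metis mod_add_left_eq mod_mult_right_eq)
  have "(c * (c * b - e + 1) + e) mod n = (b + c) mod n" for b
    by (rule modI[of _ _ "p * b - q"]) (simp add: distrib_left right_diff_distrib ccz q)
  then have 6: "(c * ((c * b - e + 1) mod n) + e) mod n = (b + c) mod n" for b
    by (metis mod_add_left_eq mod_mult_right_eq)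
  have 7: "(c * (c * b + 1)) mod n = (b + c) mod n" for b
    by (rule modI[of _ _ "p * b"]) (simp add: distrib_left right_diff_distrib ccz q)
  show ?thesis using assms(3,5)
  proof (induction arbitrary: sb rule: word_eq.induct)
    case (rel u v)
    obtain s b where sb: "sb = (s, b)" "b mod n = b" using rel.prems by (cases sb) auto
    consider "u = word_pow wx 2" "v = ypow e" | "u = word_pow wy m" "v = []"
      | "u = word_inv wx @ wy @ wx" "v = ypow c"
      using rel.hyps by (auto simp: metacyclic_rels_def)
    then show ?case
    proof cases
      case 1
      then show ?thesis
        using sb by (cases s)
          (auto simp: word_act_ypow word_pow_word_gen numeral_2_eq_2 mod_simps 2 3)
    next
      case 2
      then show ?thesis using sb by (simp add: word_pow_word_gen word_act_replicate_GenY n del: fold_replicate)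
    next
      case 3
      then show ?thesis
        using sb by (cases s)
          (auto simp: word_act_ypow word_gen_def word_inv_def mod_simps 6 7)
    qed
  next
    case (cancel a t)
    then show ?case
      by (cases sb; cases a; cases t) (auto simp: mod_simps 1 4 5)
  next
    case (append u u' v v')
    \<comment> \<open>The state between the two words has a reduced exponent, so the second
      induction hypothesis applies to it.\<close>
    then show ?case by (simp add: word_act_mod)
  qed auto
qed

text \<open>An isomorphism composed with \<open>word_class\<close> evaluates words in
  \<open>G\<close>; later arguments then use elements of \<open>G\<close> in place of word
  classes.\<close>

lemma iso_presented_group_eval:
  fixes G (structure)
  assumes "group G" "G \<cong> presented_group S"
  obtains f where "f [] = \<one>" "\<And>u v. f (u @ v) = f u \<otimes> f v"
    "\<And>u v. f u = f v \<longleftrightarrow> word_eq S u v" "range f = carrier G"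
proof -
  obtain \<phi> where \<phi>: "\<phi> \<in> iso (presented_group S) G"
    using group.iso_sym[OF assms] by (auto simp: is_iso_def)
  interpret P: group "presented_group S" by (rule group_presented_group)
  interpret G: group G by (rule assms(1))
  interpret \<phi>: group_hom "presented_group S" G \<phi>
    using \<phi> by unfold_locales (simp add: iso_def)
  have carr: "carrier (presented_group S) = range (word_class S)"
    by (simp add: presented_group_def)
  have bij: "inj_on \<phi> (range (word_class S))" "\<phi> ` range (word_class S) = carrier G"
    using \<phi> carr by (auto simp: iso_def bij_betw_def)
  show ?thesis
  proof (rule that[of "\<lambda>w. \<phi> (word_class S w)"])
    show "\<phi> (word_class S []) = \<one>"
      using \<phi>.hom_one by (simp add: presented_group_def)
    show "\<phi> (word_class S (u @ v)) = \<phi> (word_class S u) \<otimes> \<phi> (word_class S v)" for u v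
      by (subst \<phi>.hom_mult[symmetric]) (auto simp: carr presented_group_mult)
    show "\<phi> (word_class S u) = \<phi> (word_class S v) \<longleftrightarrow> word_eq S u v" for u v
      using bij(1) by (auto simp: word_class_eq_iff[symmetric] dest: inj_onD)
    show "range (\<lambda>w. \<phi> (word_class S w)) = carrier G"
      using bij(2) by (simp add: image_image)
  qed
qed

text \<open>Parity of \<open>e\<close> and \<open>c\<close> puts \<open>x^2\<close> and the
  commutator into the subgroup generated by \<open>y^2\<close>. The divisibility conditions provide
  the action on normal forms, which shows that no smaller positive power of \<open>y\<close> than
  \<open>y^(2^m)\<close> is trivial and that \<open>x\<close> is not a power of
  \<open>y\<close>.\<close>

lemma ordered_davenport_eq_loewy_length_F2_presented:
  fixes G (structure)
  assumes "group G" "G \<cong> presented_group (metacyclic_rels (2 ^ m) e c)"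
    and "even e" "odd c" "(2 ^ m) dvd c * c - 1" "(2 ^ m) dvd c * e - e"
  shows "ordered_davenport G = loewy_length_F2 G"
proof -
  let ?S = "metacyclic_rels (2 ^ m) e c"
  interpret group G by (rule assms(1))
  obtain f where f: "f [] = \<one>" "\<And>u v. f (u @ v) = f u \<otimes> f v"
    "\<And>u v. f u = f v \<longleftrightarrow> word_eq ?S u v" "range f = carrier G"
    using iso_presented_group_eval[OF assms(1,2)] by metis
  have fcl [simp]: "f w \<in> carrier G" for w using f(4) by blast
  have f_inv: "f (word_inv w) = inv (f w)" for w
  proof -
    have "f (word_inv w @ w) = f []" unfolding f(3) by (rule word_eq_inv_left)
    then show ?thesis by (intro inv_equality[symmetric]) (simp_all add: f(1,2))
  qed
  have f_pow: "f (word_pow w k) = f w [^] k" for w k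
    unfolding word_pow_def
    by (induction k) (simp_all add: f(1,2), metis fcl nat_pow_Suc nat_pow_Suc2)
  define x where "x = f wx"
  define y where "y = f wy"
  have xy [simp]: "x \<in> carrier G" "y \<in> carrier G" by (simp_all add: x_def y_def)
  have f_ypow: "f (ypow k) = y [^] k" for k
    by (auto simp: ypow_def f_inv f_pow int_pow_def2 y_def simp del: pow_nat)
  have rel: "f u = f v" if "(u, v) \<in> ?S" for u v
    using that by (simp add: f(3) word_eq.rel)
  have xx: "x \<otimes> x = y [^] e"
    using rel[of "word_pow wx 2" "ypow e"]
    by (simp add: metacyclic_rels_def f_ypow f_pow x_def[symmetric] numeral_2_eq_2)
  have yn: "y [^] ((2::nat) ^ m) = \<one>"
    using rel[of "word_pow wy (2 ^ m)" "[]"]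
    by (simp add: metacyclic_rels_def f_pow f(1) y_def[symmetric])
  have "inv x \<otimes> (y \<otimes> x) = y [^] c"
    using rel[of "word_inv wx @ wy @ wx" "ypow c"]
    by (simp add: metacyclic_rels_def f(2) f_inv f_ypow x_def[symmetric] y_def[symmetric])
  then have yx: "y \<otimes> x = x \<otimes> y [^] c"
    by (metis inv_solve_left' xy m_closed int_pow_closed inv_closed)
  have letters: "f [(GenX, True)] = x" "f [(GenY, True)] = y"
    "f [(GenX, False)] = inv x" "f [(GenY, False)] = inv y"
    using f_inv[of wx] f_inv[of wy] by (simp_all add: x_def y_def word_gen_def word_inv_def)
  have f_Cons: "f (l # w) = f [l] \<otimes> f w" for l w
    using f(2)[of "[l]" w] by simp

  \<comment> \<open>Finiteness of \<open>G\<close> is derived from the relations: the set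
    \<open>N\<close> of normal forms is stable under left multiplication by letters, so it is all of
    \<open>G\<close>, and \<open>y [^] k\<close> depends only on \<open>k\<close> modulo
    \<open>2 ^ m\<close>.\<close>
  define N where "N = range (\<lambda>k::int. y [^] k) \<union> range (\<lambda>k::int. x \<otimes> y [^] k)"
  have N1: "y [^] k \<in> N" and N2: "x \<otimes> y [^] k \<in> N" for k :: int by (auto simp: N_def)
  have x_inv: "inv x = x \<otimes> y [^] (- e)"
    using xx by (metis int_pow_closed int_pow_neg inv_solve_right' inv_solve_left' m_assoc
        l_inv r_inv inv_closed xy inv_mult_group inv_inv inv_equality m_closed)
  have yx_inv: "inv y \<otimes> x = x \<otimes> y [^] (- c)"
    using yx by (metis int_pow_closed int_pow_neg inv_solve_right inv_solve_left m_assoc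
        inv_closed xy m_closed)
  have "f w \<in> N" for w
  proof (induction w)
    case Nil
    then show ?case using N1[of 0] f(1) by simp
  next
    case (Cons l w)
    have l: "f [l] \<in> {x, y, inv x, inv y}"
      by (cases l; cases "fst l"; cases "snd l") (auto simp: letters)
    from Cons consider k :: int where "f w = y [^] k" | k :: int where "f w = x \<otimes> y [^] k"
      by (auto simp: N_def)
    then show ?case
    proof cases
      case 1
      have "x \<otimes> y [^] k \<in> N" by (rule N2)
      moreover have "inv x \<otimes> y [^] k = x \<otimes> y [^] (- e + k)"
        using int_pow_mult[of y "- e" k] by (simp add: x_inv m_assoc)
      moreover have "y \<otimes> y [^] k = y [^] (1 + k)" by (simp add: int_pow_mult)
      moreover have "inv y \<otimes> y [^] k = y [^] (- 1 + k)"
        using int_pow_mult[of y "- 1" k] by (simp add: int_pow_neg)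
      ultimately show ?thesis
        using N1 N2 l by (auto simp: f_Cons[of l w] 1)
    next
      case 2
      have "x \<otimes> (x \<otimes> y [^] k) = y [^] (e + k)"
        by (simp add: m_assoc[symmetric] xx int_pow_mult)
      moreover have "inv x \<otimes> (x \<otimes> y [^] k) = y [^] k" by (simp add: m_assoc[symmetric])
      moreover have "y \<otimes> (x \<otimes> y [^] k) = x \<otimes> y [^] (c + k)"
        by (simp add: m_assoc[symmetric] yx) (simp add: m_assoc int_pow_mult)
      moreover have "inv y \<otimes> (x \<otimes> y [^] k) = x \<otimes> y [^] (- c + k)"
        by (simp add: m_assoc[symmetric] yx_inv)
          (use int_pow_mult[of y "- c" k] in \<open>simp add: m_assoc\<close>)
      ultimately show ?thesis
        using N1 N2 l by (auto simp: f_Cons[of l w] 2)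
    qed
  qed
  then have "carrier G \<subseteq> N" unfolding f(4)[symmetric] by auto
  moreover have "finite N"
  proof -
    have "y [^] k = y [^] (k mod 2 ^ m)" for k :: int
    proof -
      have "y [^] (2 ^ m :: int) = \<one>"
        using yn int_pow_int[of G y "2 ^ m"] by simp
      then have "y [^] (2 ^ m * (k div 2 ^ m)) = \<one>"
        by (simp add: int_pow_pow[symmetric])
      then have "y [^] (2 ^ m * (k div 2 ^ m) + k mod 2 ^ m) = y [^] (k mod 2 ^ m)"
        unfolding int_pow_mult[OF xy(2)] by simp
      then show ?thesis by simp
    qed
    then have "range (\<lambda>k::int. y [^] k) \<subseteq> (\<lambda>k. y [^] k) ` {0..<2 ^ m :: int}"
      by (metis (no_types, lifting) atLeastLessThan_iff image_eqI image_subsetI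
          pos_mod_bound pos_mod_sign zero_less_numeral zero_less_power)
    then have fin: "finite (range (\<lambda>k::int. y [^] k))" by (rule finite_subset) simp
    have "range (\<lambda>k::int. x \<otimes> y [^] k) = (\<lambda>z. x \<otimes> z) ` range (\<lambda>k::int. y [^] k)" by auto
    then show ?thesis using fin by (simp add: N_def)
  qed
  ultimately have "finite (carrier G)" by (rule finite_subset)
  then interpret finite_group G by unfold_locales

  \<comment> \<open>The start \<open>(False, 0)\<close> is the normal form of \<open>\<one>\<close>,
    so words with the same value in \<open>G\<close> end in the same normal form.\<close>
  have act: "word_act (2 ^ m) e c u (False, 0) = word_act (2 ^ m) e c v (False, 0)"
    if "f u = f v" for u v
    using that assms(5,6) by (intro word_eq_imp_word_act_eq[where m = "2 ^ m"]) (auto simp: f(3))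
  have sq: "(y \<otimes> y) [^] (k::int) = y [^] (2 * k)" for k
  proof -
    have "y \<otimes> y = y [^] (2::int)" using int_pow_mult[of y 1 1] by simp
    then show ?thesis by (simp add: int_pow_pow)
  qed
  obtain i where i: "e = 2 * i" using \<open>even e\<close> by (elim evenE)
  obtain j where j: "c = 2 * j + 1" using \<open>odd c\<close> by (elim oddE)
  show ?thesis
  proof (rule ordered_davenport_eq_loewy_length_F2_metacyclic[of x y i j m])
    show "x \<otimes> x = (y \<otimes> y) [^] i" by (simp add: xx sq i)
    have "y [^] c = y \<otimes> y [^] (2 * j)"
      using int_pow_mult[of y 1 "2 * j"] by (simp add: j add.commute)
    then show "y \<otimes> x = x \<otimes> y \<otimes> (y \<otimes> y) [^] j" by (simp add: yx sq m_assoc)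
    show "y [^] ((2::nat) ^ m) = \<one>" by (rule yn)
    fix H assume H: "subgroup H G" "x \<in> H" "y \<in> H"
    have "f w \<in> H" for w
    proof (induction w)
      case Nil
      then show ?case using H by (simp add: f(1) subgroup.one_closed)
    next
      case (Cons l w)
      have "f [l] \<in> H"
        using H(2,3) subgroup.m_inv_closed[OF H(1)]
        by (cases l; cases "fst l"; cases "snd l") (simp_all add: letters)
      then show ?case using subgroup.m_closed[OF H(1)] Cons by (subst f_Cons)
    qed
    then have "carrier G \<subseteq> H" unfolding f(4)[symmetric] by auto
    with subgroup.subset[OF H(1)] show "H = carrier G" by (rule equalityI)
  next
    fix k :: nat assume k: "0 < k" "k < 2 ^ m"
    show "y [^] k \<noteq> \<one>"
    proof
      assume "y [^] k = \<one>"
      then have "f (word_pow wy k) = f []" by (simp add: f_pow f(1) y_def)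
      from act[OF this] have "int k mod 2 ^ m = 0"
        by (simp add: word_pow_word_gen word_act_replicate_GenY del: fold_replicate)
      moreover have "int k < 2 ^ m" using k by (metis of_nat_less_iff of_nat_numeral of_nat_power)
      ultimately show False using k by simp
    qed
  next
    fix k :: nat
    show "y [^] k \<otimes> x \<noteq> \<one>"
    proof
      assume "y [^] k \<otimes> x = \<one>"
      then have "f (word_pow wy k @ wx) = f []" by (simp add: f(2) f_pow f(1) x_def y_def)
      \<comment> \<open>The single letter \<open>x\<close> flips the first component, which the
        empty word leaves at \<open>False\<close>.\<close>
      from act[OF this] show False
        by (simp add: word_pow_word_gen word_act_replicate_GenY del: fold_replicate) (simp add: word_gen_def)
    qed
  qed simp_all
qed

section \<open>The four families as instances\<close>

lemma word_inv_wy: "word_inv wy = ypow (- 1)"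
  by (simp add: ypow_def word_pow_def)

lemma word_pow_wy: "word_pow wy k = ypow (int k)"
  by (simp add: ypow_def)

lemma Nil_eq_ypow: "[] = ypow 0"
  by (simp add: ypow_def word_pow_def)

text \<open>Since \<open>t^2 = 1\<close>, the square minus one is
  \<open>2^(s+1) (2^(s-1) + t)\<close>. This is the condition on \<open>c\<close> for the
  semidihedral and modular groups.\<close>

lemma two_power_dvd_square_minus_one:
  fixes t :: int
  assumes "1 \<le> s" "t = 1 \<or> t = - 1"
  shows "2 ^ Suc s dvd (2 ^ s + t) * (2 ^ s + t) - 1"
proof -
  obtain k where s: "s = Suc k" using assms(1) by (cases s) auto
  have "(2 ^ s + t) * (2 ^ s + t) - 1 = 2 ^ Suc s * (2 ^ k + t)"
    using assms(2) by (auto simp: s algebra_simps)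
  then show ?thesis by simp
qed

theorem theorem1p6:
  fixes G :: "('a, 'b) monoid_scheme" and r :: nat
  assumes "group G"
    and "r \<ge> 3 \<and> G \<cong> dihedral_2group r
       \<or> r \<ge> 3 \<and> G \<cong> quaternion_2group r
       \<or> r \<ge> 4 \<and> G \<cong> semidihedral_2group r
       \<or> r \<ge> 4 \<and> G \<cong> modular_2group r"
  shows "ordered_davenport G = loewy_length_F2 G"
proof -
  \<comment> \<open>With \<open>m = Suc s = r - 1\<close>, the pairs \<open>(e, c)\<close> are
    \<open>(0, -1)\<close>, \<open>(2^s, -1)\<close>, \<open>(0, 2^s - 1)\<close> and
    \<open>(0, 2^s + 1)\<close>.\<close>
  define s where "s = r - 2"
  have s: "1 \<le> s" "r - 2 = s" "r - 1 = Suc s" using assms(2) by (auto simp: s_def)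
  have one_le: "(1::nat) \<le> 2 ^ s" by simp
  have half: "even ((2::int) ^ s)" using s by simp
  from assms(2) consider "G \<cong> dihedral_2group r" | "G \<cong> quaternion_2group r"
    | "G \<cong> semidihedral_2group r" | "G \<cong> modular_2group r" by blast
  then show ?thesis
  proof cases
    case 1
    have "dihedral_2group r = presented_group (metacyclic_rels (2 ^ Suc s) 0 (- 1))"
      unfolding dihedral_2group_def metacyclic_rels_def s word_inv_wy
      by (simp add: Nil_eq_ypow[symmetric])
    with 1 have "G \<cong> presented_group (metacyclic_rels (2 ^ Suc s) 0 (- 1))" by (simp only:)
    then show ?thesis
      by (rule ordered_davenport_eq_loewy_length_F2_presented[OF assms(1)])
        simp_all
  next
    case 2
    have "quaternion_2group r = presented_group (metacyclic_rels (2 ^ Suc s) (2 ^ s) (- 1))"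
      unfolding quaternion_2group_def metacyclic_rels_def s word_inv_wy word_pow_wy[of "2 ^ s"]
      by simp
    with 2 have "G \<cong> presented_group (metacyclic_rels (2 ^ Suc s) (2 ^ s) (- 1))" by (simp only:)
    \<comment> \<open>Here \<open>c * e - e\<close> is \<open>- (2 ^ Suc s)\<close>, which settles
      the second divisibility condition.\<close>
    then show ?thesis
      by (rule ordered_davenport_eq_loewy_length_F2_presented[OF assms(1)])
        (use half in \<open>simp_all\<close>)
  next
    case 3
    \<comment> \<open>The form \<open>2 ^ s + - 1\<close> matches \<open>2 ^ s + t\<close> in the
      divisibility lemma; \<open>one_le\<close> turns the subtraction of natural numbers into one of
      integers.\<close>
    have "semidihedral_2group r = presented_group (metacyclic_rels (2 ^ Suc s) 0 (2 ^ s + - 1))"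
      unfolding semidihedral_2group_def metacyclic_rels_def s word_pow_wy[of "2 ^ s - 1"]
      using one_le by (simp add: Nil_eq_ypow[symmetric] of_nat_diff)
    with 3 have "G \<cong> presented_group (metacyclic_rels (2 ^ Suc s) 0 (2 ^ s + - 1))" by (simp only:)
    then show ?thesis
      by (rule ordered_davenport_eq_loewy_length_F2_presented[OF assms(1)])
        (use half two_power_dvd_square_minus_one[OF s(1), of "- 1"] in \<open>simp_all\<close>)
  next
    case 4
    have "modular_2group r = presented_group (metacyclic_rels (2 ^ Suc s) 0 (2 ^ s + 1))"
      unfolding modular_2group_def metacyclic_rels_def s word_pow_wy[of "2 ^ s + 1"]
      by (simp add: Nil_eq_ypow[symmetric] add.commute)
    with 4 have "G \<cong> presented_group (metacyclic_rels (2 ^ Suc s) 0 (2 ^ s + 1))" by (simp only:)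
    then show ?thesis
      by (rule ordered_davenport_eq_loewy_length_F2_presented[OF assms(1)])
        (use half two_power_dvd_square_minus_one[OF s(1), of 1] in \<open>simp_all\<close>)
  qed
qed

end
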